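(* Let $\mathcal{I}$ be an ideal and let $n\ge 3$. Every $n$-$\mathcal{I}$-generic set computes an $n$-$COMP$-generic set.
   Context: Sets are subsets of $\omega$. A (Turing) ideal is a (countable) collection of sets closed under $\le_T$ and $\oplus$. Each ideal $\mathcal{I}$ is presented by a fixed exact pair $A_0,A_1$ (so $S\in\mathcal{I}$ iff $S\le_T A_0$ and $S\le_T A_1$), and $\Sigma^0_n(\mathcal{I})$ means $\Sigma^0_n(A_0\oplus A_1)$. $COMP$ is the ideal of computable sets (presented by a computable exact pair, so $\Sigma^0_n(COMP)=\Sigma^0_n$). A Mathias condition is a pair $(D,S)$ with $D$ finite, $S$ infinite, $\max D<\min S$; $(\widetilde D,\widetilde S)$ extends $(D,S)$ if $D\subseteq\widetilde D\subseteq D\cup S$ and $\widetilde S\subseteq S$. A set $X$ satisfies $(D,S)$ if $D\subseteq X\subseteq D\cup S$; $X$ meets a collection $\mathcal{C}$ of conditions if it satisfies a member of $\mathcal{C}$, and avoids $\mathcal{C}$ if it satisfies a condition with no extension in $\mathcal{C}$. An $\mathcal{I}$-condition is a Mathias condition $(D,S)$ with $S\in\mathcal{I}$. A set $G$ is $n$-$\mathcal{I}$-generic if it meets or avoids every $\Sigma^0_n(\mathcal{I})$-definable collection of $\mathcal{I}$-conditions. *)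

theory Defs
  imports Main "HOL-Library.Nat_Bijection" "HOL-Library.Countable_Set"
begin

section \<open>Oracle computability\<close>

text \<open>
  Partial recursive functions relative to an oracle, as unary functions on the naturals with
  tuples coded by \<^const>\<open>prod_encode\<close>. \<open>Query\<close> asks the oracle for its
  characteristic function.
\<close>

datatype code =
    Zero | Succ | Fst | Snd | Query
  | Pairing code code | Compose code code | PrimRec code code | Minimize code

definition char_fun :: "nat set \<Rightarrow> nat \<Rightarrow> nat" where
  "char_fun A x = (if x \<in> A then 1 else 0)"

inductive evals :: "nat set \<Rightarrow> code \<Rightarrow> nat \<Rightarrow> nat \<Rightarrow> bool" for A :: "nat set" where
  Zero: "evals A Zero x 0"
| Succ: "evals A Succ x (Suc x)"
| Fst: "evals A Fst (prod_encode (x, y)) x"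
| Snd: "evals A Snd (prod_encode (x, y)) y"
| Query: "evals A Query x (char_fun A x)"
| Pairing: "evals A c x y \<Longrightarrow> evals A d x z \<Longrightarrow> evals A (Pairing c d) x (prod_encode (y, z))"
| Compose: "evals A d x y \<Longrightarrow> evals A c y z \<Longrightarrow> evals A (Compose c d) x z"
| PrimRec_0: "evals A c x y \<Longrightarrow> evals A (PrimRec c d) (prod_encode (x, 0)) y"
| PrimRec_Suc: "evals A (PrimRec c d) (prod_encode (x, k)) y \<Longrightarrow>
    evals A d (prod_encode (x, prod_encode (k, y))) z \<Longrightarrow>
    evals A (PrimRec c d) (prod_encode (x, Suc k)) z"
| Minimize: "evals A c (prod_encode (x, y)) 0 \<Longrightarrow>
    (\<forall>k<y. \<exists>v. evals A c (prod_encode (x, k)) (Suc v)) \<Longrightarrow>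
    evals A (Minimize c) x y"

inductive_cases evals_ZeroE: "evals A Zero x y"
inductive_cases evals_SuccE: "evals A Succ x y"
inductive_cases evals_FstE: "evals A Fst x y"
inductive_cases evals_SndE: "evals A Snd x y"
inductive_cases evals_QueryE: "evals A Query x y"
inductive_cases evals_PairingE: "evals A (Pairing c d) x y"
inductive_cases evals_ComposeE: "evals A (Compose c d) x y"
inductive_cases evals_PrimRecE: "evals A (PrimRec c d) x y"
inductive_cases evals_MinimizeE: "evals A (Minimize c) x y"

lemma evals_deterministic: "evals A c x y \<Longrightarrow> evals A c x z \<Longrightarrow> y = z"
proof (induction arbitrary: z rule: evals.induct)
  case (Zero x)
  then show ?case by (auto elim: evals_ZeroE)
next
  case (Succ x)
  then show ?case by (auto elim: evals_SuccE)
next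
  case (Fst x y)
  then show ?case by (auto elim: evals_FstE)
next
  case (Snd x y)
  then show ?case by (auto elim: evals_SndE)
next
  case (Query x)
  then show ?case by (auto elim: evals_QueryE)
next
  case (Pairing c x y d w)
  from Pairing.prems show ?case
    by (rule evals_PairingE) (use Pairing.IH in blast)
next
  case (Compose d x y c w)
  from Compose.prems show ?case
    by (rule evals_ComposeE) (use Compose.IH in blast)
next
  case (PrimRec_0 c x y d)
  from PrimRec_0.prems show ?case
    by (rule evals_PrimRecE) (use PrimRec_0.IH in auto)
next
  case (PrimRec_Suc c d x k y w)
  from PrimRec_Suc.prems show ?case
    by (rule evals_PrimRecE) (use PrimRec_Suc.IH in auto)
next
  case (Minimize c x y)
  from Minimize.prems show ?case
  proof (rule evals_MinimizeE)
    assume z: "evals A c (prod_encode (x, z)) 0"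
      and below: "\<forall>k<z. \<exists>v. evals A c (prod_encode (x, k)) (Suc v)"
    have "\<not> y < z"
      using below Minimize.IH by (metis nat.distinct(1))
    moreover have "\<not> z < y"
      using z Minimize.IH by (metis nat.distinct(1))
    ultimately show ?thesis by simp
  qed
qed

fun encode_code :: "code \<Rightarrow> nat" where
  "encode_code Zero = 0"
| "encode_code Succ = 1"
| "encode_code Fst = 2"
| "encode_code Snd = 3"
| "encode_code Query = 4"
| "encode_code (Pairing c d) = 5 + 4 * prod_encode (encode_code c, encode_code d)"
| "encode_code (Compose c d) = 6 + 4 * prod_encode (encode_code c, encode_code d)"
| "encode_code (PrimRec c d) = 7 + 4 * prod_encode (encode_code c, encode_code d)"
| "encode_code (Minimize c) = 8 + 4 * encode_code c"

lemma inj_encode_code: "inj encode_code"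
proof (rule injI)
  show "encode_code c = encode_code d \<Longrightarrow> c = d" for c d
  proof (induction c arbitrary: d)
    case (Pairing c1 c2)
    then show ?case by (cases d) (auto, presburger+)
  next
    case (Compose c1 c2)
    then show ?case by (cases d) (auto, presburger+)
  next
    case (PrimRec c1 c2)
    then show ?case by (cases d) (auto, presburger+)
  next
    case (Minimize c)
    then show ?case by (cases d) (auto, presburger+)
  qed (case_tac d; simp)+
qed

text \<open>\<open>computes A e S\<close>: the \<open>e\<close>-th Turing functional with oracle \<open>A\<close> is total and equals the
  characteristic function of \<open>S\<close>. Numbers that code no program compute nothing.\<close>

definition computes :: "nat set \<Rightarrow> nat \<Rightarrow> nat set \<Rightarrow> bool" where
  "computes A e S \<longleftrightarrow> (\<exists>c. encode_code c = e \<and> (\<forall>x. evals A c x (char_fun S x)))"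

definition turing_le :: "nat set \<Rightarrow> nat set \<Rightarrow> bool" (infix "\<le>\<^sub>T" 50) where
  "S \<le>\<^sub>T A \<longleftrightarrow> (\<exists>e. computes A e S)"

definition turing_join :: "nat set \<Rightarrow> nat set \<Rightarrow> nat set" (infixl "\<oplus>\<^sub>T" 65) where
  "A \<oplus>\<^sub>T B = {2 * x |x. x \<in> A} \<union> {2 * x + 1 |x. x \<in> B}"

text \<open>A set is \<open>\<Sigma>\<^sub>0\<close> in \<open>A\<close> if it is computable in \<open>A\<close>, and \<open>\<Sigma>\<^sub>n\<^sub>+\<^sub>1\<close> in \<open>A\<close> if it is a projection
  of the complement of a set that is \<open>\<Sigma>\<^sub>n\<close> in \<open>A\<close>.\<close>

fun Sigma0 :: "nat \<Rightarrow> nat set \<Rightarrow> nat set set" where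
  "Sigma0 0 A = {S. S \<le>\<^sub>T A}"
| "Sigma0 (Suc n) A = {{x. \<exists>y. prod_encode (x, y) \<notin> P} |P. P \<in> Sigma0 n A}"


section \<open>Turing ideals\<close>

definition turing_ideal :: "nat set set \<Rightarrow> bool" where
  "turing_ideal I \<longleftrightarrow> I \<noteq> {} \<and> countable I \<and>
     (\<forall>S\<in>I. \<forall>R. R \<le>\<^sub>T S \<longrightarrow> R \<in> I) \<and> (\<forall>R\<in>I. \<forall>S\<in>I. R \<oplus>\<^sub>T S \<in> I)"

definition exact_pair :: "nat set set \<Rightarrow> nat set \<Rightarrow> nat set \<Rightarrow> bool" where
  "exact_pair I A0 A1 \<longleftrightarrow> (\<forall>S. S \<in> I \<longleftrightarrow> S \<le>\<^sub>T A0 \<and> S \<le>\<^sub>T A1)"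

definition COMP :: "nat set set" where
  "COMP = {S. S \<le>\<^sub>T {}}"

lemma exact_pair_COMP: "exact_pair COMP {} {}"
  by (simp add: exact_pair_def COMP_def)


section \<open>Mathias forcing\<close>

type_synonym condition = "nat set \<times> nat set"

definition mathias_condition :: "condition \<Rightarrow> bool" where
  "mathias_condition = (\<lambda>(D, S). finite D \<and> infinite S \<and> (\<forall>d\<in>D. \<forall>s\<in>S. d < s))"

definition ideal_condition :: "nat set set \<Rightarrow> condition \<Rightarrow> bool" where
  "ideal_condition I p \<longleftrightarrow> mathias_condition p \<and> snd p \<in> I"

definition extends :: "condition \<Rightarrow> condition \<Rightarrow> bool" where
  "extends = (\<lambda>(D', S') (D, S). D \<subseteq> D' \<and> D' \<subseteq> D \<union> S \<and> S' \<subseteq> S)"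

definition satisfies :: "nat set \<Rightarrow> condition \<Rightarrow> bool" where
  "satisfies X = (\<lambda>(D, S). D \<subseteq> X \<and> X \<subseteq> D \<union> S)"

definition meets :: "nat set \<Rightarrow> condition set \<Rightarrow> bool" where
  "meets X C \<longleftrightarrow> (\<exists>p\<in>C. satisfies X p)"

text \<open>The avoiding condition has to be a condition of the forcing notion at hand. With arbitrary
  Mathias conditions \<open>(D, S)\<close>, every infinite set \<open>X\<close> without an infinite subset in \<open>I\<close> would
  avoid every collection of \<open>I\<close>-conditions through \<open>({}, X)\<close>.\<close>

definition avoids :: "nat set set \<Rightarrow> nat set \<Rightarrow> condition set \<Rightarrow> bool" where
  "avoids I X C \<longleftrightarrow>
     (\<exists>p. ideal_condition I p \<and> satisfies X p \<and> \<not> (\<exists>q\<in>C. extends q p))"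

text \<open>An index of \<open>(D, S)\<close> relative to an exact pair consists of the canonical index of the finite
  set \<open>D\<close> and indices of \<open>S\<close> relative to both members of the pair.\<close>

definition condition_index :: "nat set \<Rightarrow> nat set \<Rightarrow> nat \<Rightarrow> condition \<Rightarrow> bool" where
  "condition_index A0 A1 i = (\<lambda>(D, S). \<exists>e0 e1.
     i = prod_encode (set_encode D, prod_encode (e0, e1)) \<and>
     computes A0 e0 S \<and> computes A1 e1 S)"

definition Sigma0_collection ::
    "nat \<Rightarrow> nat set set \<Rightarrow> nat set \<Rightarrow> nat set \<Rightarrow> condition set \<Rightarrow> bool" where
  "Sigma0_collection n I A0 A1 C \<longleftrightarrow>
     (\<forall>p\<in>C. ideal_condition I p) \<and>
     {i. \<exists>p\<in>C. condition_index A0 A1 i p} \<in> Sigma0 n (A0 \<oplus>\<^sub>T A1)"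

text \<open>\<open>mathias_generic n I A0 A1 G\<close>: \<open>G\<close> is \<open>n\<close>-\<open>I\<close>-generic, for \<open>I\<close> presented by the exact pair
  \<open>A0\<close>, \<open>A1\<close>.\<close>

definition mathias_generic ::
    "nat \<Rightarrow> nat set set \<Rightarrow> nat set \<Rightarrow> nat set \<Rightarrow> nat set \<Rightarrow> bool" where
  "mathias_generic n I A0 A1 G \<longleftrightarrow>
     (\<forall>C. Sigma0_collection n I A0 A1 C \<longrightarrow> meets G C \<or> avoids I G C)"

end

theory Submission
  imports Defs
begin

text \<open>
  Suppose first that some \<open>B \<in> I\<close> below \<open>G\<close> computes a relation \<open>R\<close> whose projection is not in \<open>I\<close>. No
  infinite \<open>S \<in> I\<close> is sparse enough for each element to bound the settling times of the projection
  below the preceding elements, so below every \<open>I\<close>-condition one may choose freely whether the next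
  gap of \<open>G\<close> exceeds the settling time or not. \<open>G\<close> reads these bits with a delay of one element, so
  arbitrary numbers, in particular indices of computable conditions, can be coded into \<open>G\<close>. A stack
  of programs for their reservoirs is maintained along \<open>G\<close>; a program that is not total, or that
  leaves a finite reservoir, eventually fails the bounded searches and is popped, while the genuine
  entries survive because \<open>G\<close> can be made to grow faster than their search times. The finite parts of
  the accepted conditions form \<open>H\<close>, and each extension of the computable condition currently coded can
  be forced by extending the \<open>I\<close>-condition.

  Otherwise \<open>I\<close> contains the projection of every relation that is computable in some \<open>B \<in> I\<close> below
  \<open>G\<close>. Then \<open>G\<close> dominates the settling times of this projection and hence computes it. Thus the
  members of \<open>I\<close> below \<open>G\<close> form a jump ideal, and every jump ideal contains a generic built by the
  usual step-by-step construction.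
\<close>

section \<open>Functions computable in an oracle\<close>

abbreviation prod_code :: "nat \<Rightarrow> nat \<Rightarrow> nat" ("\<langle>_,/ _\<rangle>") where
  "\<langle>x, y\<rangle> \<equiv> prod_encode (x, y)"

definition proj1 :: "nat \<Rightarrow> nat" where
  "proj1 p = fst (prod_decode p)"

definition proj2 :: "nat \<Rightarrow> nat" where
  "proj2 p = snd (prod_decode p)"

lemma proj_prod_code [simp]: "proj1 \<langle>x, y\<rangle> = x" "proj2 \<langle>x, y\<rangle> = y" "\<langle>proj1 p, proj2 p\<rangle> = p"
  by (simp_all add: proj1_def proj2_def)

lemma proj_le: "proj1 p \<le> p" "proj2 p \<le> p"
  by (metis le_prod_encode_1 proj_prod_code(3), metis le_prod_encode_2 proj_prod_code(3))

lemma proj_0 [simp]: "proj1 0 = 0" "proj2 0 = 0"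
  using proj_le[of 0] by simp_all

lemma set_decode_less: "x \<in> set_decode n \<Longrightarrow> x < n"
proof -
  assume "x \<in> set_decode n"
  then have "set_decode (2 ^ x) \<subseteq> set_decode n" using set_encode_inverse[of "{x}"] by simp
  then have "2 ^ x \<le> n" by (rule subset_decode_imp_le)
  then show "x < n" using less_exp[of x] by linarith
qed

lemma evals_proj:
  "evals A Fst x (proj1 x)"
  "evals A Snd x (proj2 x)"
  "evals A c x (proj1 y) \<Longrightarrow> evals A d x (proj2 y) \<Longrightarrow> evals A (Pairing c d) x y"
  "proj2 x = 0 \<Longrightarrow> evals A c (proj1 x) y \<Longrightarrow> evals A (PrimRec c d) x y"
  "proj2 x = Suc k \<Longrightarrow> evals A (PrimRec c d) \<langle>proj1 x, k\<rangle> z \<Longrightarrow> evals A d \<langle>proj1 x, \<langle>k, z\<rangle>\<rangle> y \<Longrightarrow>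
    evals A (PrimRec c d) x y"
  by (metis evals.Fst evals.Snd evals.Pairing evals.PrimRec_0 evals.PrimRec_Suc proj_prod_code(3))+

definition computable :: "nat set \<Rightarrow> (nat \<Rightarrow> nat) \<Rightarrow> bool" where
  "computable A f \<longleftrightarrow> (\<exists>c. \<forall>x. evals A c x (f x))"

definition decidable :: "nat set \<Rightarrow> (nat \<Rightarrow> bool) \<Rightarrow> bool" where
  "decidable A P \<longleftrightarrow> computable A (\<lambda>x. of_bool (P x))"

abbreviation computable2 :: "nat set \<Rightarrow> (nat \<Rightarrow> nat \<Rightarrow> nat) \<Rightarrow> bool" where
  "computable2 A f \<equiv> computable A (\<lambda>p. f (proj1 p) (proj2 p))"

abbreviation computable3 :: "nat set \<Rightarrow> (nat \<Rightarrow> nat \<Rightarrow> nat \<Rightarrow> nat) \<Rightarrow> bool" where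
  "computable3 A f \<equiv> computable A (\<lambda>p. f (proj1 p) (proj1 (proj2 p)) (proj2 (proj2 p)))"

abbreviation decidable2 :: "nat set \<Rightarrow> (nat \<Rightarrow> nat \<Rightarrow> bool) \<Rightarrow> bool" where
  "decidable2 A P \<equiv> decidable A (\<lambda>p. P (proj1 p) (proj2 p))"

abbreviation decidable3 :: "nat set \<Rightarrow> (nat \<Rightarrow> nat \<Rightarrow> nat \<Rightarrow> bool) \<Rightarrow> bool" where
  "decidable3 A P \<equiv> decidable A (\<lambda>p. P (proj1 p) (proj1 (proj2 p)) (proj2 (proj2 p)))"

text \<open>
  The rules for recursion, bounded quantifiers and least witnesses replace the bound variables by
  projections of a single argument, so that \<open>intro computable_intros\<close> decides explicitly given
  predicates.
\<close>

named_theorems computable_intros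

lemma turing_le_iff_decidable: "S \<le>\<^sub>T A \<longleftrightarrow> decidable A (\<lambda>x. x \<in> S)"
  by (auto simp: turing_le_def computes_def decidable_def computable_def char_fun_def of_bool_def)

lemma computable_proj1_id: "computable A proj1"
  unfolding computable_def using evals_proj(1) by blast

lemma computable_proj2_id: "computable A proj2"
  unfolding computable_def using evals_proj(2) by blast

lemma computable_prod_code [computable_intros]:
  "computable A f \<Longrightarrow> computable A g \<Longrightarrow> computable A (\<lambda>x. \<langle>f x, g x\<rangle>)"
  unfolding computable_def by (meson evals.Pairing)

lemma computable_comp: "computable A f \<Longrightarrow> computable A g \<Longrightarrow> computable A (\<lambda>x. f (g x))"
  unfolding computable_def by (meson evals.Compose)

lemma decidable_comp: "decidable A P \<Longrightarrow> computable A f \<Longrightarrow> decidable A (\<lambda>x. P (f x))"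
  unfolding decidable_def by (rule computable_comp)

lemmas computable_proj1 [computable_intros] = computable_comp[OF computable_proj1_id]
lemmas computable_proj2 [computable_intros] = computable_comp[OF computable_proj2_id]

lemma computable_id [computable_intros]: "computable A (\<lambda>x. x)"
  using computable_prod_code[OF computable_proj1_id computable_proj2_id] by simp

lemma computable2_comp:
  "computable2 A h \<Longrightarrow> computable A f \<Longrightarrow> computable A g \<Longrightarrow> computable A (\<lambda>x. h (f x) (g x))"
  using computable_comp[OF _ computable_prod_code] by fastforce

lemma computable3_comp:
  assumes "computable3 A k" "computable A f" "computable A g" "computable A h"
  shows "computable A (\<lambda>x. k (f x) (g x) (h x))"
  using assms computable_comp[OF assms(1), of "\<lambda>x. \<langle>f x, \<langle>g x, h x\<rangle>\<rangle>"]
  by (simp add: computable_prod_code)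

lemma decidable2_comp:
  "decidable2 A P \<Longrightarrow> computable A f \<Longrightarrow> computable A g \<Longrightarrow> decidable A (\<lambda>x. P (f x) (g x))"
  unfolding decidable_def by (rule computable2_comp)

lemma decidable3_comp:
  "decidable3 A P \<Longrightarrow> computable A f \<Longrightarrow> computable A g \<Longrightarrow> computable A h \<Longrightarrow>
    decidable A (\<lambda>x. P (f x) (g x) (h x))"
  unfolding decidable_def by (rule computable3_comp)

lemma computable_Suc [computable_intros]: "computable A f \<Longrightarrow> computable A (\<lambda>x. Suc (f x))"
  by (rule computable_comp[of A Suc]) (auto simp: computable_def intro: evals.Succ)

lemma computable_const [computable_intros]: "computable A (\<lambda>x. k)"
proof (induction k)
  case 0
  show ?case unfolding computable_def using evals.Zero by blast
qed (rule computable_Suc)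

lemma computable_primrec:
  assumes F_Suc: "\<And>x k. F x (Suc k) = h x k (F x k)"
    and F_0: "computable A (\<lambda>x. F x 0)" and computable_h: "computable3 A h"
      and computable_n: "computable A n"
  shows "computable A (\<lambda>x. F x (n x))"
proof -
  obtain c where evals_c: "\<And>x. evals A c x (F x 0)" using F_0 by (auto simp: computable_def)
  obtain d where evals_d: "\<And>p. evals A d p (h (proj1 p) (proj1 (proj2 p)) (proj2 (proj2 p)))"
    using computable_h by (auto simp: computable_def)
  have "evals A (PrimRec c d) \<langle>x, k\<rangle> (F x k)" for x k
  proof (induction k)
    case 0
    show ?case using evals_c by (rule evals.PrimRec_0)
  next
    case (Suc k)
    show ?case using evals.PrimRec_Suc[OF Suc evals_d] by (simp add: F_Suc)
  qed
  then have "computable2 A F" unfolding computable_def by (metis proj_prod_code(3))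
  then show ?thesis using computable_id computable_n by (rule computable2_comp)
qed

lemma computable_add [computable_intros]:
  assumes "computable A f" "computable A g"
  shows "computable A (\<lambda>x. f x + g x)"
proof (rule computable_primrec[where F = "\<lambda>x k. f x + k" and h = "\<lambda>_ _ y. Suc y" and n = g])
  show "computable3 A (\<lambda>_ _ y. Suc y)" by (intro computable_intros)
qed (simp_all add: assms)

lemma computable_mult [computable_intros]:
  assumes "computable A f" "computable A g"
  shows "computable A (\<lambda>x. f x * g x)"
proof (rule computable_primrec[where F = "\<lambda>x k. f x * k" and h = "\<lambda>x _ y. f x + y" and n = g])
  show "computable3 A (\<lambda>x _ y. f x + y)"
    by (intro computable_intros computable_comp[OF assms(1)])
qed (simp_all add: assms computable_const)

lemma computable_pred: "computable A f \<Longrightarrow> computable A (\<lambda>x. f x - 1)"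
proof (rule computable_primrec[where F = "\<lambda>_ k. k - 1" and h = "\<lambda>_ k _. k" and n = f])
  show "computable3 A (\<lambda>_ k _. k)" by (intro computable_intros)
qed (simp_all add: computable_const)

lemma computable_diff [computable_intros]:
  assumes "computable A f" "computable A g"
  shows "computable A (\<lambda>x. f x - g x)"
proof (rule computable_primrec[where F = "\<lambda>x k. f x - k" and h = "\<lambda>_ _ y. y - 1" and n = g])
  show "computable3 A (\<lambda>_ _ y. y - 1)" by (intro computable_pred computable_intros)
qed (simp_all add: assms)

lemma computable_power [computable_intros]:
  assumes "computable A f" "computable A g"
  shows "computable A (\<lambda>x. f x ^ g x)"
proof (rule computable_primrec[where F = "\<lambda>x k. f x ^ k" and h = "\<lambda>x _ y. f x * y" and n = g])
  show "computable3 A (\<lambda>x _ y. f x * y)"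
    by (intro computable_intros computable_comp[OF assms(1)])
qed (simp_all add: assms computable_const)

lemma computable_funpow [computable_intros]:
  assumes "computable2 A f" "computable A g" "computable A n"
  shows "computable A (\<lambda>x. (f x ^^ n x) (g x))"
proof (rule computable_primrec[where F = "\<lambda>x k. (f x ^^ k) (g x)"
      and h = "\<lambda>x _ y. f x y" and n = n])
  show "computable3 A (\<lambda>x _ y. f x y)" by (intro computable2_comp[OF assms(1)] computable_intros)
qed (simp_all add: assms)

lemma computable_if [computable_intros]:
  assumes "decidable A P" "computable A f" "computable A g"
  shows "computable A (\<lambda>x. if P x then f x else g x)"
proof -
  define F where "F x k = (if k = (0::nat) then g x else f x)" for x k
  have "computable A (\<lambda>x. F x (of_bool (P x)))"
  proof (rule computable_primrec[where F = F and h = "\<lambda>x _ _. f x" and n = "\<lambda>x. of_bool (P x)"])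
    show "computable3 A (\<lambda>x _ _. f x)" by (intro computable_comp[OF assms(2)] computable_intros)
  qed (use assms in \<open>simp_all add: F_def decidable_def\<close>)
  moreover have "F x (of_bool (P x)) = (if P x then f x else g x)" for x by (simp add: F_def)
  ultimately show ?thesis by simp
qed

lemma decidable_eq_0: "computable A f \<Longrightarrow> decidable A (\<lambda>x. f x = 0)"
  unfolding decidable_def
  by (rule computable_primrec[where F = "\<lambda>x k. of_bool (k = 0)" and h = "\<lambda>x k y. 0" and n = f])
    (simp_all add: computable_const)

lemma decidable_const [computable_intros]: "decidable A (\<lambda>x. b)"
  unfolding decidable_def by (rule computable_const)

lemma decidable_not [computable_intros]: "decidable A P \<Longrightarrow> decidable A (\<lambda>x. \<not> P x)"
  using decidable_eq_0[of A "\<lambda>x. of_bool (P x)"] by (simp add: decidable_def)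

lemma decidable_if [computable_intros]:
  assumes "decidable A P" "decidable A Q" "decidable A R"
  shows "decidable A (\<lambda>x. if P x then Q x else R x)"
  using computable_if[OF assms(1) assms(2,3)[unfolded decidable_def]]
  unfolding decidable_def if_distrib[of of_bool] .

lemma decidable_conj [computable_intros]:
  assumes "decidable A P" "decidable A Q"
  shows "decidable A (\<lambda>x. P x \<and> Q x)"
proof -
  have "(P x \<and> Q x) = (if P x then Q x else False)" for x by simp
  then show ?thesis using decidable_if[OF assms decidable_const] by presburger
qed

lemma decidable_disj [computable_intros]:
  "decidable A P \<Longrightarrow> decidable A Q \<Longrightarrow> decidable A (\<lambda>x. P x \<or> Q x)"
  using decidable_not[OF decidable_conj[OF decidable_not[of A P] decidable_not[of A Q]]] by simp

lemma decidable_imp [computable_intros]: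
  "decidable A P \<Longrightarrow> decidable A Q \<Longrightarrow> decidable A (\<lambda>x. P x \<longrightarrow> Q x)"
  unfolding imp_conv_disj by (intro computable_intros)

lemma decidable_le [computable_intros]:
  "computable A f \<Longrightarrow> computable A g \<Longrightarrow> decidable A (\<lambda>x. f x \<le> g x)"
  using decidable_eq_0[OF computable_diff[of A f g]] by simp

lemma decidable_less [computable_intros]:
  "computable A f \<Longrightarrow> computable A g \<Longrightarrow> decidable A (\<lambda>x. f x < g x)"
  unfolding less_eq_Suc_le by (intro computable_intros)

lemma decidable_eq [computable_intros]:
  fixes f g :: "nat \<Rightarrow> nat"
  shows "computable A f \<Longrightarrow> computable A g \<Longrightarrow> decidable A (\<lambda>x. f x = g x)"
  unfolding eq_iff by (intro computable_intros)

lemma decidable_ex_less [computable_intros]: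
  assumes decidable_P: "decidable2 A P" and computable_b: "computable A b"
  shows "decidable A (\<lambda>x. \<exists>k<b x. P x k)"
  unfolding decidable_def
proof (rule computable_primrec[where F = "\<lambda>x b. of_bool (\<exists>k<b. P x k)"
      and h = "\<lambda>x k y. if P x k then 1 else y" and n = b])
  show "computable3 A (\<lambda>x k y. if P x k then 1 else y)"
    by (intro decidable2_comp[OF decidable_P] computable_intros)
  show "of_bool (\<exists>j<Suc k. P x j) = (if P x k then 1 else of_bool (\<exists>j<k. P x j))" for x k
    by (auto simp: less_Suc_eq)
qed (simp_all add: computable_const computable_b)

lemma decidable_all_less [computable_intros]:
  assumes "decidable2 A P" "computable A b"
  shows "decidable A (\<lambda>x. \<forall>k<b x. P x k)"
  using decidable_not[OF decidable_ex_less[OF decidable_not[OF assms(1)] assms(2)]] by simp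

lemma decidable_ex_le [computable_intros]:
  "decidable2 A P \<Longrightarrow> computable A b \<Longrightarrow> decidable A (\<lambda>x. \<exists>k\<le>b x. P x k)"
  unfolding less_Suc_eq_le[symmetric] by (intro computable_intros)

lemma decidable_all_le [computable_intros]:
  "decidable2 A P \<Longrightarrow> computable A b \<Longrightarrow> decidable A (\<lambda>x. \<forall>k\<le>b x. P x k)"
  unfolding less_Suc_eq_le[symmetric] by (intro computable_intros)

lemma mem_set_decode_iff: "x \<in> set_decode n \<longleftrightarrow> (\<exists>q\<le>n. \<exists>r<2^x. n = (2 * q + 1) * 2 ^ x + r)"
proof
  assume "x \<in> set_decode n"
  then have "odd (n div 2 ^ x)" by (simp add: set_decode_def)
  then obtain q where quotient: "n div 2 ^ x = 2 * q + 1" by (elim oddE)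
  then have "q \<le> n div 2 ^ x" by simp
  then have "q \<le> n" using div_le_dividend le_trans by blast
  moreover have "n = (2 * q + 1) * 2 ^ x + n mod 2 ^ x" by (metis quotient div_mult_mod_eq)
  moreover have "n mod 2 ^ x < 2 ^ x" by simp
  ultimately show "\<exists>q\<le>n. \<exists>r<2^x. n = (2 * q + 1) * 2 ^ x + r" by blast
next
  assume "\<exists>q\<le>n. \<exists>r<2^x. n = (2 * q + 1) * 2 ^ x + r"
  then obtain q r where "r < 2 ^ x" "n = (2 * q + 1) * 2 ^ x + r" by blast
  then have "n div 2 ^ x = 2 * q + 1" by (intro div_nat_eqI) (auto simp: algebra_simps)
  then show "x \<in> set_decode n" by (simp add: set_decode_def)
qed

lemma decidable_set_decode [computable_intros]:
  assumes "computable A f" "computable A g"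
  shows "decidable A (\<lambda>x. f x \<in> set_decode (g x))"
proof -
  have "decidable2 A (\<lambda>x n. x \<in> set_decode n)"
    unfolding mem_set_decode_iff by (intro computable_intros)
  then show ?thesis using assms by (rule decidable2_comp)
qed

lemma decidable_Ball_set_decode [computable_intros]:
  assumes "decidable2 A P" "computable A f"
  shows "decidable A (\<lambda>x. \<forall>z\<in>set_decode (f x). P x z)"
proof -
  have "(\<forall>z\<in>set_decode n. Q z) \<longleftrightarrow> (\<forall>z<n. z \<in> set_decode n \<longrightarrow> Q z)" for n Q
    using set_decode_less by blast
  then show ?thesis
    by (simp only:) (intro computable_intros assms computable_comp[OF assms(2)])
qed

lemma decidable_Bex_set_decode [computable_intros]:
  assumes "decidable2 A P" "computable A f"
  shows "decidable A (\<lambda>x. \<exists>z\<in>set_decode (f x). P x z)"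
  using decidable_not[OF decidable_Ball_set_decode[OF decidable_not[OF assms(1)] assms(2)]] by simp

lemma computable_Least [computable_intros]:
  assumes decidable_P: "decidable2 A P" and ex_P: "\<And>x. \<exists>k. P x k"
  shows "computable A (\<lambda>x. LEAST k. P x k)"
proof -
  obtain c where evals_c: "\<And>p. evals A c p (of_bool (\<not> P (proj1 p) (proj2 p)))"
    using decidable_not[OF decidable_P] by (auto simp: decidable_def computable_def)
  have "evals A (Minimize c) x (LEAST k. P x k)" for x
  proof (rule evals.Minimize)
    show "evals A c \<langle>x, LEAST k. P x k\<rangle> 0"
      using evals_c[of "\<langle>x, LEAST k. P x k\<rangle>"] LeastI_ex[OF ex_P[of x]] by simp
    show "\<forall>k<LEAST k. P x k. \<exists>v. evals A c \<langle>x, k\<rangle> (Suc v)"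
    proof (intro allI impI)
      fix k assume "k < (LEAST k. P x k)"
      then have "\<not> P x k" by (rule not_less_Least)
      then show "\<exists>v. evals A c \<langle>x, k\<rangle> (Suc v)" using evals_c[of "\<langle>x, k\<rangle>"] by auto
    qed
  qed
  then show ?thesis by (auto simp: computable_def)
qed

lemma decidable_if_semidecidable:
  assumes decidable_P: "decidable2 A P" and decidable_Q: "decidable2 A Q"
    and S_iff: "\<And>x. S x \<longleftrightarrow> (\<exists>y. P x y)" and not_S_iff: "\<And>x. \<not> S x \<longleftrightarrow> (\<exists>y. Q x y)"
  shows "decidable A S"
proof -
  define witness where "witness x = (LEAST y. P x y \<or> Q x y)" for x
  have ex_P_or_Q: "\<exists>y. P x y \<or> Q x y" for x using S_iff not_S_iff by blast
  have "computable A witness" unfolding witness_def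
    by (intro computable_intros decidable_P decidable_Q ex_P_or_Q)
  then have "decidable A (\<lambda>x. P x (witness x))"
    by (intro decidable2_comp[OF decidable_P] computable_id)
  moreover have "S x \<longleftrightarrow> P x (witness x)" for x
    using LeastI_ex[OF ex_P_or_Q[of x]] S_iff not_S_iff unfolding witness_def by blast
  ultimately show ?thesis by presburger
qed

section \<open>Turing reducibility\<close>

primrec subst_query :: "code \<Rightarrow> code \<Rightarrow> code" where
  "subst_query q Zero = Zero"
| "subst_query q Succ = Succ"
| "subst_query q Fst = Fst"
| "subst_query q Snd = Snd"
| "subst_query q Query = q"
| "subst_query q (Pairing c d) = Pairing (subst_query q c) (subst_query q d)"
| "subst_query q (Compose c d) = Compose (subst_query q c) (subst_query q d)"
| "subst_query q (PrimRec c d) = PrimRec (subst_query q c) (subst_query q d)"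
| "subst_query q (Minimize c) = Minimize (subst_query q c)"

lemma evals_subst_query:
  assumes "\<And>x. evals A q x (char_fun B x)" "evals B c x y"
  shows "evals A (subst_query q c) x y"
  using assms(2)
proof induction
  case (Minimize c x y)
  then show ?case by (auto intro!: evals.Minimize)
qed (auto intro: evals.intros assms(1))

lemma computable_mono: "B \<le>\<^sub>T A \<Longrightarrow> computable B f \<Longrightarrow> computable A f"
  unfolding computable_def turing_le_def computes_def using evals_subst_query by meson

lemma decidable_mono: "B \<le>\<^sub>T A \<Longrightarrow> decidable B P \<Longrightarrow> decidable A P"
  unfolding decidable_def by (rule computable_mono)

lemma turing_le_trans [trans]: "A \<le>\<^sub>T B \<Longrightarrow> B \<le>\<^sub>T C \<Longrightarrow> A \<le>\<^sub>T C"
  using decidable_mono turing_le_iff_decidable by blast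

lemma turing_le_refl: "A \<le>\<^sub>T A"
  unfolding turing_le_def computes_def using evals.Query by blast

lemma decidable_mem: "B \<le>\<^sub>T A \<Longrightarrow> computable A f \<Longrightarrow> decidable A (\<lambda>x. f x \<in> B)"
  using decidable_comp turing_le_iff_decidable by blast

lemma empty_turing_le: "{} \<le>\<^sub>T A"
  by (simp add: turing_le_iff_decidable decidable_const)

lemma turing_join_iff:
  "2 * x \<in> A \<oplus>\<^sub>T B \<longleftrightarrow> x \<in> A" "Suc (2 * x) \<in> A \<oplus>\<^sub>T B \<longleftrightarrow> x \<in> B"
  unfolding turing_join_def by (auto; presburger)+

lemma turing_le_join1: "A \<le>\<^sub>T A \<oplus>\<^sub>T B"
  unfolding turing_le_iff_decidable
  by (subst turing_join_iff(1)[of _ A B, symmetric])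
    (intro decidable_mem turing_le_refl computable_intros)

lemma turing_le_join2: "B \<le>\<^sub>T A \<oplus>\<^sub>T B"
  unfolding turing_le_iff_decidable
  by (subst turing_join_iff(2)[of _ A B, symmetric])
    (intro decidable_mem turing_le_refl computable_intros)

lemma turing_join_le: "A \<le>\<^sub>T C \<Longrightarrow> B \<le>\<^sub>T C \<Longrightarrow> A \<oplus>\<^sub>T B \<le>\<^sub>T C"
proof -
  assume le: "A \<le>\<^sub>T C" "B \<le>\<^sub>T C"
  have "z \<in> A \<oplus>\<^sub>T B \<longleftrightarrow> (\<exists>k\<le>z. z = 2 * k \<and> k \<in> A \<or> z = 2 * k + 1 \<and> k \<in> B)" for z
  proof -
    have "x \<le> 2 * x" "x \<le> 2 * x + 1" for x :: nat by simp_all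
    then show ?thesis unfolding turing_join_def by blast
  qed
  then show ?thesis
    unfolding turing_le_iff_decidable
    by (simp only:) (intro computable_intros decidable_mem[OF le(1)] decidable_mem[OF le(2)])
qed

lemma empty_join_empty: "{} \<oplus>\<^sub>T {} = {}"
  by (simp add: turing_join_def)

section \<open>Bounded evaluation\<close>

definition built_from :: "nat set \<Rightarrow> nat \<Rightarrow> bool" where
  "built_from K e \<longleftrightarrow> e < 5 \<or>
     (\<exists>k<e. (e = 5 + 4 * k \<or> e = 6 + 4 * k \<or> e = 7 + 4 * k) \<and> proj1 k \<in> K \<and> proj2 k \<in> K) \<or>
     (\<exists>k<e. e = 8 + 4 * k \<and> k \<in> K)"

lemma built_from_mono:
  assumes "built_from K e" "\<And>k. k < e \<Longrightarrow> k \<in> K \<Longrightarrow> k \<in> L"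
  shows "built_from L e"
proof -
  have "proj1 k \<in> L \<and> proj2 k \<in> L" if "k < e" "proj1 k \<in> K" "proj2 k \<in> K" for k
    using that assms(2) proj_le[of k] by (meson le_less_trans)
  then show ?thesis using assms unfolding built_from_def by blast
qed

lemma built_from_range_iff: "built_from (range encode_code) e \<longleftrightarrow> e \<in> range encode_code"
proof
  assume "built_from (range encode_code) e"
  then consider (basic) "e < 5"
    | (binary) k c d where "e = 5 + 4 * k \<or> e = 6 + 4 * k \<or> e = 7 + 4 * k"
        "proj1 k = encode_code c" "proj2 k = encode_code d"
    | (unary) k c where "e = 8 + 4 * k" "k = encode_code c"
    unfolding built_from_def by blast
  then show "e \<in> range encode_code"
  proof cases
    case basic
    then have "e = 0 \<or> e = 1 \<or> e = 2 \<or> e = 3 \<or> e = 4" by auto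
    then show ?thesis by (metis encode_code.simps(1-5) rangeI)
  next
    case (binary k c d)
    then have "k = \<langle>encode_code c, encode_code d\<rangle>" by (metis proj_prod_code(3))
    then show ?thesis using binary(1) encode_code.simps(6-8)[of c d] by (metis rangeI)
  next
    case (unary k c)
    then show ?thesis using encode_code.simps(9)[of c] by (metis rangeI)
  qed
next
  assume "e \<in> range encode_code"
  then obtain c where "e = encode_code c" by blast
  moreover have "built_from (range encode_code) (i + 4 * \<langle>encode_code c, encode_code d\<rangle>)"
    if "i \<in> {5, 6, 7}" for i c d
    unfolding built_from_def using that
    by (intro disjI2 disjI1 exI[of _ "\<langle>encode_code c, encode_code d\<rangle>"]) auto
  ultimately show "built_from (range encode_code) e"
    by (cases c) (simp_all, auto simp: built_from_def)
qed

lemma built_from_closed_subset_range: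
  assumes closed: "\<And>d. d \<in> K \<Longrightarrow> built_from K d"
  shows "e \<in> K \<Longrightarrow> e \<in> range encode_code"
proof (induction e rule: less_induct)
  case (less e)
  have "built_from (range encode_code) e"
    using closed[OF less.prems] less.IH by (rule built_from_mono)
  then show ?case by (simp only: built_from_range_iff)
qed

lemma set_encode_less_power2: "K \<subseteq> {..<m} \<Longrightarrow> set_encode K < 2 ^ m"
proof -
  assume bounded: "K \<subseteq> {..<m}"
  have "set_encode K \<le> (\<Sum>k<m. 2 ^ k)"
    unfolding set_encode_def using bounded by (intro sum_mono2) auto
  also have "\<dots> < 2 ^ m" by (simp add: lessThan_atLeast0 sum_power2)
  finally show ?thesis .
qed

lemma range_encode_code_iff:
  "e \<in> range encode_code \<longleftrightarrow>
     (\<exists>w<2 ^ Suc e. (\<forall>d\<in>set_decode w. built_from (set_decode w) d) \<and> e \<in> set_decode w)"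
proof
  let ?K = "range encode_code \<inter> {..e}"
  assume "e \<in> range encode_code"
  moreover have "built_from ?K d" if "d \<in> ?K" for d
    using that built_from_mono[of "range encode_code" d ?K] by (simp add: built_from_range_iff)
  moreover have "set_encode ?K < 2 ^ Suc e" by (rule set_encode_less_power2) auto
  ultimately show
    "\<exists>w<2 ^ Suc e. (\<forall>d\<in>set_decode w. built_from (set_decode w) d) \<and> e \<in> set_decode w"
    by (intro exI[of _ "set_encode ?K"]) simp
qed (use built_from_closed_subset_range in blast)

lemma decidable_range_encode_code:
  "computable A f \<Longrightarrow> decidable A (\<lambda>x. f x \<in> range encode_code)"
proof (rule decidable_comp)
  show "decidable A (\<lambda>e. e \<in> range encode_code)"
    unfolding range_encode_code_iff built_from_def by (intro computable_intros)
qed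

text \<open>
  A finite set of quadruples \<open>(r, e, x, y)\<close> is a derivation if each claim \<open>e(x) = y\<close> follows by an
  evaluation rule from claims of smaller rank \<open>r\<close>. Unlike lists of claims, such sets are closed
  under union.
\<close>

definition entry_below :: "nat set \<Rightarrow> nat \<Rightarrow> nat \<Rightarrow> nat \<Rightarrow> nat \<Rightarrow> bool" where
  "entry_below W r e x y \<longleftrightarrow> (\<exists>r'<r. \<langle>r', \<langle>e, \<langle>x, y\<rangle>\<rangle>\<rangle> \<in> W)"

fun justified :: "nat set \<Rightarrow> nat set \<Rightarrow> nat \<Rightarrow> code \<Rightarrow> nat \<Rightarrow> nat \<Rightarrow> bool" where
  "justified A W r Zero x y \<longleftrightarrow> y = 0"
| "justified A W r Succ x y \<longleftrightarrow> y = Suc x"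
| "justified A W r Fst x y \<longleftrightarrow> y = proj1 x"
| "justified A W r Snd x y \<longleftrightarrow> y = proj2 x"
| "justified A W r Query x y \<longleftrightarrow> y = char_fun A x"
| "justified A W r (Pairing c d) x y \<longleftrightarrow>
     entry_below W r (encode_code c) x (proj1 y) \<and> entry_below W r (encode_code d) x (proj2 y)"
| "justified A W r (Compose c d) x y \<longleftrightarrow>
     (\<exists>z. entry_below W r (encode_code d) x z \<and> entry_below W r (encode_code c) z y)"
| "justified A W r (PrimRec c d) x y \<longleftrightarrow>
     (if proj2 x = 0 then entry_below W r (encode_code c) (proj1 x) y
      else \<exists>z. entry_below W r (encode_code (PrimRec c d)) \<langle>proj1 x, proj2 x - 1\<rangle> z \<and>
        entry_below W r (encode_code d) \<langle>proj1 x, \<langle>proj2 x - 1, z\<rangle>\<rangle> y)"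
| "justified A W r (Minimize c) x y \<longleftrightarrow>
     entry_below W r (encode_code c) \<langle>x, y\<rangle> 0 \<and>
     (\<forall>j<y. \<exists>z. entry_below W r (encode_code c) \<langle>x, j\<rangle> (Suc z))"

definition derivation :: "nat set \<Rightarrow> nat set \<Rightarrow> bool" where
  "derivation A W \<longleftrightarrow> (\<forall>z\<in>W. \<exists>c. encode_code c = proj1 (proj2 z) \<and>
     justified A W (proj1 z) c (proj1 (proj2 (proj2 z))) (proj2 (proj2 (proj2 z))))"

lemma derivationD:
  assumes "derivation A W" "entry_below W r e x y"
  obtains r' c where "r' < r" "encode_code c = e" "justified A W r' c x y"
  using assms unfolding derivation_def entry_below_def by (metis proj_prod_code(1,2))

lemma derivation_sound:
  assumes "derivation A W"
  shows "entry_below W r (encode_code c) x y \<Longrightarrow> evals A c x y"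
proof (induction r arbitrary: c x y rule: less_induct)
  case (less r)
  obtain r' where "r' < r" and just: "justified A W r' c x y"
    using derivationD[OF assms less.prems] inj_encode_code by (metis injD)
  note IH = less.IH[OF \<open>r' < r\<close>]
  show ?case
  proof (cases c)
    case (Pairing d1 d2)
    then show ?thesis using just IH evals_proj(3) by simp
  next
    case (Compose d1 d2)
    then show ?thesis using just IH evals.Compose by (metis justified.simps(7))
  next
    case (PrimRec d1 d2)
    show ?thesis
    proof (cases "proj2 x")
      case 0
      then show ?thesis using just IH evals_proj(4) PrimRec by simp
    next
      case (Suc k)
      then obtain z where "evals A c \<langle>proj1 x, k\<rangle> z" "evals A d2 \<langle>proj1 x, \<langle>k, z\<rangle>\<rangle> y"
        using just IH PrimRec by (auto simp del: encode_code.simps)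
      then show ?thesis using evals_proj(5) Suc PrimRec by simp
    qed
  next
    case (Minimize d)
    then show ?thesis using just IH evals.Minimize by (metis justified.simps(9))
  qed (use just in \<open>auto intro: evals.intros evals_proj\<close>)
qed

lemma entry_below_mono:
  "entry_below W r e x y \<Longrightarrow> W \<subseteq> W' \<Longrightarrow> r \<le> r' \<Longrightarrow> entry_below W' r' e x y"
  unfolding entry_below_def by (meson less_le_trans subsetD)

lemma justified_mono:
  assumes "justified A W r c x y" "W \<subseteq> W'"
  shows "justified A W' r c x y"
proof -
  note mono = entry_below_mono[OF _ assms(2) order_refl]
  show ?thesis
    using assms(1) mono by (cases c) (simp_all split: if_splits, (meson mono)+)
qed

lemma derivation_insert:
  "derivation A W \<Longrightarrow> justified A W r c x y \<Longrightarrow> derivation A (insert \<langle>r, \<langle>encode_code c, \<langle>x, y\<rangle>\<rangle>\<rangle> W)"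
  unfolding derivation_def using justified_mono[OF _ subset_insertI]
  by (metis insertE proj_prod_code(1,2))

lemma derivation_Union: "(\<And>W. W \<in> \<W> \<Longrightarrow> derivation A W) \<Longrightarrow> derivation A (\<Union>\<W>)"
  unfolding derivation_def using justified_mono by (metis Union_iff Union_upper)

definition derivable :: "nat set \<Rightarrow> code \<Rightarrow> nat \<Rightarrow> nat \<Rightarrow> bool" where
  "derivable A c x y \<longleftrightarrow>
     (\<exists>W r. finite W \<and> derivation A W \<and> entry_below W r (encode_code c) x y)"

lemma derivable_if_justified:
  assumes "finite J" "\<forall>(c, x, y)\<in>J. derivable A c x y"
    and just: "\<And>W r. \<forall>(c, x, y)\<in>J. entry_below W r (encode_code c) x y \<Longrightarrow> justified A W r c0 x0 y0"
  shows "derivable A c0 x0 y0"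
proof -
  have "\<forall>j\<in>J. \<exists>W r. finite W \<and> derivation A W \<and>
      (case j of (c, x, y) \<Rightarrow> entry_below W r (encode_code c) x y)"
    using assms(2) by (auto simp: derivable_def)
  then obtain W r where derivations: "\<And>j. j \<in> J \<Longrightarrow> finite (W j)" "\<And>j. j \<in> J \<Longrightarrow> derivation A (W j)"
    and entry: "\<And>j. j \<in> J \<Longrightarrow> case j of (c, x, y) \<Rightarrow> entry_below (W j) (r j) (encode_code c) x y"
    by metis
  define W' where "W' = (\<Union>j\<in>J. W j)"
  define r' where "r' = (\<Sum>j\<in>J. r j)"
  have "derivation A W'" unfolding W'_def by (rule derivation_Union) (use derivations(2) in auto)
  moreover have "justified A W' r' c0 x0 y0"
  proof (rule just, clarify)
    fix c x y assume premise: "(c, x, y) \<in> J"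
    have "W (c, x, y) \<subseteq> W'" "r (c, x, y) \<le> r'"
      using premise \<open>finite J\<close> by (auto simp: W'_def r'_def intro: member_le_sum)
    then show "entry_below W' r' (encode_code c) x y"
      using entry[OF premise] entry_below_mono by simp
  qed
  ultimately have "derivation A (insert \<langle>r', \<langle>encode_code c0, \<langle>x0, y0\<rangle>\<rangle>\<rangle> W')" (is "derivation A ?W")
    by (rule derivation_insert)
  moreover have "finite ?W" using derivations(1) \<open>finite J\<close> by (auto simp: W'_def)
  moreover have "entry_below ?W (Suc r') (encode_code c0) x0 y0" by (auto simp: entry_below_def)
  ultimately show ?thesis unfolding derivable_def by blast
qed

lemma evals_derivable: "evals A c x y \<Longrightarrow> derivable A c x y"
proof (induction rule: evals.induct)
  case (Pairing c x y d z)
  then show ?case by (intro derivable_if_justified[of "{(c, x, y), (d, x, z)}"]) auto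
next
  case (Compose d x y c z)
  then show ?case by (intro derivable_if_justified[of "{(d, x, y), (c, y, z)}"]) auto
next
  case (PrimRec_0 c x y d)
  then show ?case by (intro derivable_if_justified[of "{(c, x, y)}"]) auto
next
  case (PrimRec_Suc c d x k y z)
  then show ?case
    by (intro derivable_if_justified[of "{(PrimRec c d, \<langle>x, k\<rangle>, y), (d, \<langle>x, \<langle>k, y\<rangle>\<rangle>, z)}"]) auto
next
  case (Minimize c x y)
  then obtain v where nonzero: "\<And>k. k < y \<Longrightarrow> derivable A c \<langle>x, k\<rangle> (Suc (v k))" by metis
  let ?premises = "insert (c, \<langle>x, y\<rangle>, 0) ((\<lambda>k. (c, \<langle>x, k\<rangle>, Suc (v k))) ` {..<y})"
  show ?case
  proof (rule derivable_if_justified)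
    show "\<forall>(c, x, y)\<in>?premises. derivable A c x y" using nonzero Minimize.IH(1) by auto
    show "justified A W r (Minimize c) x y"
      if "\<forall>(c, x, y)\<in>?premises. entry_below W r (encode_code c) x y" for W r
      using that by auto
  qed simp
qed (rule derivable_if_justified[of "{}"], simp_all)+

definition converges :: "nat set \<Rightarrow> nat \<Rightarrow> nat \<Rightarrow> nat \<Rightarrow> nat \<Rightarrow> bool" where
  "converges A e x y t \<longleftrightarrow>
     (\<exists>w<t. derivation A (set_decode w) \<and> entry_below (set_decode w) w e x y)"

lemma converges_mono: "converges A e x y t \<Longrightarrow> t \<le> t' \<Longrightarrow> converges A e x y t'"
  unfolding converges_def by (meson less_le_trans)

lemma entry_less:
  assumes "\<langle>r, \<langle>e, \<langle>x, y\<rangle>\<rangle>\<rangle> \<in> set_decode w"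
  shows "r < w" "y < w"
proof -
  have "\<langle>r, \<langle>e, \<langle>x, y\<rangle>\<rangle>\<rangle> < w" using assms by (rule set_decode_less)
  then show "r < w" "y < w"
    by (meson le_prod_encode_1 le_prod_encode_2 le_less_trans)+
qed

lemma ex_converges_iff: "(\<exists>t. converges A e x y t) \<longleftrightarrow> (\<exists>c. encode_code c = e \<and> evals A c x y)"
proof
  assume "\<exists>t. converges A e x y t"
  then obtain W r where "derivation A W" "entry_below W r e x y" by (auto simp: converges_def)
  then obtain c where "encode_code c = e" by (elim derivationD)
  then show "\<exists>c. encode_code c = e \<and> evals A c x y"
    using \<open>derivation A W\<close> \<open>entry_below W r e x y\<close> derivation_sound by blast
next
  assume "\<exists>c. encode_code c = e \<and> evals A c x y"
  then obtain c where "encode_code c = e" "derivable A c x y" using evals_derivable by blast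
  then obtain W r where derivation_W: "finite W" "derivation A W" "entry_below W r e x y"
    by (auto simp: derivable_def)
  let ?w = "set_encode W"
  have "entry_below (set_decode ?w) ?w e x y"
    using derivation_W(1,3) entry_less(1)[of _ e x y ?w] by (auto simp: entry_below_def)
  then have "converges A e x y (Suc ?w)"
    unfolding converges_def using derivation_W by (intro exI[of _ ?w]) simp
  then show "\<exists>t. converges A e x y t" ..
qed

definition justified_index :: "nat set \<Rightarrow> nat set \<Rightarrow> nat \<Rightarrow> nat \<Rightarrow> nat \<Rightarrow> nat \<Rightarrow> bool" where
  "justified_index A W r e x y \<longleftrightarrow>
     e = 0 \<and> y = 0 \<or> e = 1 \<and> y = Suc x \<or> e = 2 \<and> y = proj1 x \<or> e = 3 \<and> y = proj2 x \<or>
     e = 4 \<and> y = (if x \<in> A then 1 else 0) \<or>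
     (\<exists>k<e. e = 5 + 4 * k \<and>
        entry_below W r (proj1 k) x (proj1 y) \<and> entry_below W r (proj2 k) x (proj2 y)) \<or>
     (\<exists>k<e. e = 6 + 4 * k \<and>
        (\<exists>z. entry_below W r (proj2 k) x z \<and> entry_below W r (proj1 k) z y)) \<or>
     (\<exists>k<e. e = 7 + 4 * k \<and>
        (if proj2 x = 0 then entry_below W r (proj1 k) (proj1 x) y
         else \<exists>z. entry_below W r e \<langle>proj1 x, proj2 x - 1\<rangle> z \<and>
           entry_below W r (proj2 k) \<langle>proj1 x, \<langle>proj2 x - 1, z\<rangle>\<rangle> y)) \<or>
     (\<exists>k<e. e = 8 + 4 * k \<and> entry_below W r k \<langle>x, y\<rangle> 0 \<and>
        (\<forall>j<y. \<exists>z. entry_below W r k \<langle>x, j\<rangle> (Suc z)))"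

lemma justified_iff_index: "justified A W r c x y \<longleftrightarrow> justified_index A W r (encode_code c) x y"
proof -
  have "4 * j \<noteq> Suc (4 * k)" "4 * j \<noteq> Suc (Suc (4 * k))" "4 * j \<noteq> 3 + 4 * k" for j k :: nat
    by presburger+
  note distinct = this this[symmetric]
  show ?thesis by (cases c) (auto simp: justified_index_def char_fun_def distinct)
qed

lemma ex_justified_iff:
  "(\<exists>c. encode_code c = e \<and> justified A W r c x y) \<longleftrightarrow>
     e \<in> range encode_code \<and> justified_index A W r e x y"
  unfolding justified_iff_index by blast

lemma decidable_derivation:
  assumes "B \<le>\<^sub>T A" "computable A f"
  shows "decidable A (\<lambda>x. derivation B (set_decode (f x)))"
proof -
  have bound:
    "(\<exists>z. entry_below (set_decode w) r e x z \<and> P z) \<longleftrightarrow>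
       (\<exists>z<w. entry_below (set_decode w) r e x z \<and> P z)"
    "(\<exists>z. entry_below (set_decode w) r e x (Suc z)) \<longleftrightarrow>
       (\<exists>z<w. entry_below (set_decode w) r e x (Suc z))" for w r e x P
    unfolding entry_below_def using entry_less(2) Suc_lessD by blast+
  have "decidable A (\<lambda>w. derivation B (set_decode w))"
    unfolding derivation_def ex_justified_iff justified_index_def bound
    unfolding entry_below_def
    by (intro computable_intros decidable_range_encode_code decidable_mem[OF assms(1)])
  then show ?thesis using assms(2) by (rule decidable_comp)
qed

lemma decidable_converges:
  assumes "B \<le>\<^sub>T A" "computable A e" "computable A x" "computable A y" "computable A t"
  shows "decidable A (\<lambda>p. converges B (e p) (x p) (y p) (t p))"
  unfolding converges_def entry_below_def
  by (intro computable_intros decidable_derivation assms computable_comp[OF assms(2)]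
      computable_comp[OF assms(3)] computable_comp[OF assms(4)])

section \<open>The arithmetical hierarchy\<close>

lemma Sigma0_SucI:
  assumes "P \<in> Sigma0 n A" "\<And>x. x \<in> S \<longleftrightarrow> (\<exists>y. \<langle>x, y\<rangle> \<notin> P)"
  shows "S \<in> Sigma0 (Suc n) A"
proof -
  have "S = {x. \<exists>y. \<langle>x, y\<rangle> \<notin> P}" using assms(2) by blast
  then show ?thesis using assms(1) by auto
qed

lemma Sigma0_SucE:
  assumes "S \<in> Sigma0 (Suc n) A"
  obtains P where "P \<in> Sigma0 n A" "\<And>x. x \<in> S \<longleftrightarrow> (\<exists>y. \<langle>x, y\<rangle> \<notin> P)"
  using assms by auto

lemma Sigma0_vimage: "S \<in> Sigma0 n A \<Longrightarrow> computable A f \<Longrightarrow> {x. f x \<in> S} \<in> Sigma0 n A"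
proof (induction n arbitrary: S f)
  case 0
  then show ?case by (auto simp: turing_le_iff_decidable intro: decidable_comp)
next
  case (Suc n)
  from Suc.prems(1) obtain P where S_projection: "P \<in> Sigma0 n A" "\<And>x. x \<in> S \<longleftrightarrow> (\<exists>y. \<langle>x, y\<rangle> \<notin> P)"
    by (rule Sigma0_SucE) blast
  have "computable A (\<lambda>p. \<langle>f (proj1 p), proj2 p\<rangle>)"
    by (intro computable_intros computable_comp[OF Suc.prems(2)])
  from Suc.IH[OF S_projection(1) this] show ?case
    by (rule Sigma0_SucI) (simp add: S_projection(2))
qed

lemma Sigma0_Int_Un:
  "S \<in> Sigma0 n A \<Longrightarrow> R \<in> Sigma0 n A \<Longrightarrow> S \<inter> R \<in> Sigma0 n A \<and> S \<union> R \<in> Sigma0 n A"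
proof (induction n arbitrary: S R)
  case 0
  then show ?case by (auto simp: turing_le_iff_decidable intro: decidable_conj decidable_disj)
next
  case (Suc n)
  from Suc.prems(1) obtain P where S_projection: "P \<in> Sigma0 n A" "\<And>x. x \<in> S \<longleftrightarrow> (\<exists>y. \<langle>x, y\<rangle> \<notin> P)"
    by (rule Sigma0_SucE) blast
  from Suc.prems(2) obtain Q where R_projection: "Q \<in> Sigma0 n A" "\<And>x. x \<in> R \<longleftrightarrow> (\<exists>y. \<langle>x, y\<rangle> \<notin> Q)"
    by (rule Sigma0_SucE) blast
  have "S \<union> R \<in> Sigma0 (Suc n) A"
    by (rule Sigma0_SucI[of "P \<inter> Q"])
      (use Suc.IH[OF S_projection(1) R_projection(1)] S_projection(2) R_projection(2) in auto)
  moreover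
  let ?P = "{p. \<langle>proj1 p, proj1 (proj2 p)\<rangle> \<in> P}" and ?Q = "{p. \<langle>proj1 p, proj2 (proj2 p)\<rangle> \<in> Q}"
  have "?P \<in> Sigma0 n A" "?Q \<in> Sigma0 n A"
    by (intro Sigma0_vimage S_projection(1) R_projection(1) computable_intros)+
  then have "?P \<union> ?Q \<in> Sigma0 n A" using Suc.IH by blast
  then have "S \<inter> R \<in> Sigma0 (Suc n) A"
  proof (rule Sigma0_SucI)
    fix x
    show "x \<in> S \<inter> R \<longleftrightarrow> (\<exists>y. \<langle>x, y\<rangle> \<notin> ?P \<union> ?Q)"
    proof
      assume "x \<in> S \<inter> R"
      then obtain y z where "\<langle>x, y\<rangle> \<notin> P" "\<langle>x, z\<rangle> \<notin> Q" using S_projection(2) R_projection(2) by blast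
      then have "\<langle>x, \<langle>y, z\<rangle>\<rangle> \<notin> ?P \<union> ?Q" by simp
      then show "\<exists>y. \<langle>x, y\<rangle> \<notin> ?P \<union> ?Q" ..
    qed (use S_projection(2) R_projection(2) in auto)
  qed
  ultimately show ?case by simp
qed

lemmas Sigma0_Int = Sigma0_Int_Un[THEN conjunct1]

lemma Sigma0_Suc_mono: "Sigma0 n A \<subseteq> Sigma0 (Suc n) A"
proof (induction n)
  case 0
  show ?case
  proof
    fix S assume "S \<in> Sigma0 0 A"
    then have "S \<le>\<^sub>T A" by simp
    then have "decidable A (\<lambda>p. \<not> proj1 p \<in> S)" by (intro decidable_mem computable_intros)
    then have "{p. proj1 p \<notin> S} \<in> Sigma0 0 A" by (simp add: turing_le_iff_decidable)
    then show "S \<in> Sigma0 (Suc 0) A" by (rule Sigma0_SucI) simp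
  qed
next
  case (Suc n)
  show ?case
  proof
    fix S assume "S \<in> Sigma0 (Suc n) A"
    then obtain P where "P \<in> Sigma0 n A" "\<And>x. x \<in> S \<longleftrightarrow> (\<exists>y. \<langle>x, y\<rangle> \<notin> P)"
      by (rule Sigma0_SucE) blast
    with Suc.IH show "S \<in> Sigma0 (Suc (Suc n)) A"
      by (intro Sigma0_SucI[of P "Suc n"]) (rule subsetD)
  qed
qed

lemma Sigma0_mono: "m \<le> n \<Longrightarrow> S \<in> Sigma0 m A \<Longrightarrow> S \<in> Sigma0 n A"
  using lift_Suc_mono_le[of "\<lambda>n. Sigma0 n A", OF Sigma0_Suc_mono] by blast

lemma Sigma0_oracle_mono: "B \<le>\<^sub>T A \<Longrightarrow> S \<in> Sigma0 n B \<Longrightarrow> S \<in> Sigma0 n A"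
proof (induction n arbitrary: S)
  case 0
  then show ?case using turing_le_trans by auto
next
  case (Suc n)
  then show ?case by (metis Sigma0_SucE Sigma0_SucI)
qed

lemma Sigma0_decidable: "decidable A P \<Longrightarrow> {x. P x} \<in> Sigma0 n A"
  by (rule Sigma0_mono[of 0]) (simp_all add: turing_le_iff_decidable)

lemma Sigma0_3_all_ex:
  assumes "decidable3 A R"
  shows "{x. \<forall>y. \<exists>z. R x y z} \<in> Sigma0 3 A"
proof -
  have "decidable A (\<lambda>q. \<not> R (proj1 (proj1 (proj1 q))) (proj2 (proj1 q)) (proj2 q))"
    by (intro computable_intros decidable3_comp[OF assms])
  then have "{q. \<not> R (proj1 (proj1 (proj1 q))) (proj2 (proj1 q)) (proj2 q)} \<in> Sigma0 0 A"
    by (rule Sigma0_decidable)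
  then have "{p. \<exists>z. R (proj1 (proj1 p)) (proj2 p) z} \<in> Sigma0 1 A"
    unfolding One_nat_def by (rule Sigma0_SucI) simp
  then have "{x. \<exists>y. \<forall>z. \<not> R (proj1 x) y z} \<in> Sigma0 (Suc 1) A"
    by (rule Sigma0_SucI) simp
  then have "{x. \<forall>y. \<exists>z. R x y z} \<in> Sigma0 (Suc (Suc 1)) A"
    by (rule Sigma0_SucI) simp
  then show ?thesis by (simp only: numeral_3_eq_3 One_nat_def)
qed

section \<open>Indices of conditions\<close>

definition accepted :: "nat set \<Rightarrow> nat \<Rightarrow> nat set" where
  "accepted A e = {x. \<exists>t. converges A e x 1 t}"

lemma ex_converges_computes_iff:
  assumes "computes A e S"
  shows "(\<exists>t. converges A e x v t) \<longleftrightarrow> v = char_fun S x"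
  using assms ex_converges_iff[of A e x v] evals_deterministic inj_encode_code
  unfolding computes_def inj_def by metis

lemma computes_if_converges:
  assumes "\<And>x. f x < 2" "\<And>x. \<exists>t. converges A e x (f x) t"
  shows "computes A e {x. f x = 1}"
proof -
  define S where "S = {x. f x = 1}"
  have f_eq: "f x = char_fun S x" for x using assms(1)[of x] by (auto simp: S_def char_fun_def)
  have "\<exists>c. encode_code c = e \<and> evals A c x (char_fun S x)" for x
    using assms(2)[of x] unfolding ex_converges_iff f_eq .
  then show ?thesis using inj_encode_code unfolding computes_def inj_def S_def[symmetric] by metis
qed

lemma accepted_eq: "computes A e S \<Longrightarrow> accepted A e = S"
  by (auto simp: accepted_def ex_converges_computes_iff char_fun_def)

definition indexed_condition :: "nat set \<Rightarrow> nat \<Rightarrow> condition" where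
  "indexed_condition A i = (set_decode (proj1 i), accepted A (proj1 (proj2 i)))"

definition valid_index :: "nat set \<Rightarrow> nat set \<Rightarrow> nat \<Rightarrow> bool" where
  "valid_index A0 A1 i \<longleftrightarrow>
     (\<exists>S. computes A0 (proj1 (proj2 i)) S \<and> computes A1 (proj2 (proj2 i)) S)"

lemma condition_index_iff:
  assumes "finite (fst p)"
  shows "condition_index A0 A1 i p \<longleftrightarrow> valid_index A0 A1 i \<and> p = indexed_condition A0 i"
proof
  assume "condition_index A0 A1 i p"
  then show "valid_index A0 A1 i \<and> p = indexed_condition A0 i"
    using assms accepted_eq
    by (auto simp: condition_index_def valid_index_def indexed_condition_def)
next
  assume "valid_index A0 A1 i \<and> p = indexed_condition A0 i"
  then show "condition_index A0 A1 i p"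
    using accepted_eq unfolding condition_index_def valid_index_def indexed_condition_def
    by (intro case_prodI2 exI[of _ "proj1 (proj2 i)"] exI[of _ "proj2 (proj2 i)"]) auto
qed

lemma valid_index_iff:
  "valid_index A0 A1 i \<longleftrightarrow>
     (\<forall>x. \<exists>t. \<exists>v<2. converges A0 (proj1 (proj2 i)) x v t \<and> converges A1 (proj2 (proj2 i)) x v t)"
  (is "_ \<longleftrightarrow> (\<forall>x. \<exists>t. \<exists>v<2. converges A0 ?e0 x v t \<and> converges A1 ?e1 x v t)")
proof
  assume "\<forall>x. \<exists>t. \<exists>v<2. converges A0 ?e0 x v t \<and> converges A1 ?e1 x v t"
  then obtain f where common_value: "\<And>x. f x < 2" "\<And>x. \<exists>t. converges A0 ?e0 x (f x) t"
    "\<And>x. \<exists>t. converges A1 ?e1 x (f x) t"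
    by metis
  then show "valid_index A0 A1 i"
    using computes_if_converges[of f] unfolding valid_index_def by blast
next
  assume "valid_index A0 A1 i"
  then obtain S where computes_S: "computes A0 ?e0 S" "computes A1 ?e1 S"
    by (auto simp: valid_index_def)
  show "\<forall>x. \<exists>t. \<exists>v<2. converges A0 ?e0 x v t \<and> converges A1 ?e1 x v t"
  proof
    fix x
    obtain t t' where "converges A0 ?e0 x (char_fun S x) t" "converges A1 ?e1 x (char_fun S x) t'"
      using ex_converges_computes_iff[OF computes_S(1)] ex_converges_computes_iff[OF computes_S(2)]
      by blast
    then have "converges A0 ?e0 x (char_fun S x) (t + t')"
      "converges A1 ?e1 x (char_fun S x) (t + t')"
      by (auto elim: converges_mono)
    moreover have "char_fun S x < 2" by (simp add: char_fun_def)
    ultimately show "\<exists>t. \<exists>v<2. converges A0 ?e0 x v t \<and> converges A1 ?e1 x v t" by blast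
  qed
qed

lemma Sigma0_3_valid_index: "{i. valid_index A0 A1 i} \<in> Sigma0 3 (A0 \<oplus>\<^sub>T A1)"
  unfolding valid_index_iff
  by (intro Sigma0_3_all_ex computable_intros
      decidable_converges[OF turing_le_join1] decidable_converges[OF turing_le_join2])

lemma Sigma0_3_infinite_accepted:
  assumes "B \<le>\<^sub>T A" "computable A f"
  shows "{i. infinite (accepted B (f i))} \<in> Sigma0 3 A"
proof -
  have "infinite (accepted B e) \<longleftrightarrow> (\<forall>x. \<exists>z. x < proj1 z \<and> converges B e (proj1 z) 1 (proj2 z))" for e
    unfolding infinite_nat_iff_unbounded accepted_def mem_Collect_eq by (metis proj_prod_code(1,2))
  then show ?thesis
    by (simp only:) (intro Sigma0_3_all_ex computable_intros decidable_converges assms(1)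
      computable_comp[OF assms(2)])
qed

lemma Sigma0_3_all_accepted_pairs:
  assumes "B \<le>\<^sub>T A" "computable A f" "decidable3 A R"
  shows "{i. \<forall>x\<in>accepted B (f i). \<forall>y\<in>accepted B (f i). R i x y} \<in> Sigma0 3 A"
proof -
  have "(\<forall>x\<in>accepted B e. \<forall>y\<in>accepted B e. Q x y) \<longleftrightarrow>
      (\<forall>q. converges B e (proj1 q) 1 (proj2 (proj2 q)) \<longrightarrow>
        converges B e (proj1 (proj2 q)) 1 (proj2 (proj2 q)) \<longrightarrow> Q (proj1 q) (proj1 (proj2 q)))"
    (is "?lhs \<longleftrightarrow> ?rhs") for e Q
  proof
    assume rhs: ?rhs
    show ?lhs
    proof (intro ballI)
      fix x y assume "x \<in> accepted B e" "y \<in> accepted B e"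
      then obtain t t' where "converges B e x 1 t" "converges B e y 1 t'"
        by (auto simp: accepted_def)
      then have "converges B e x 1 (t + t')" "converges B e y 1 (t + t')"
        by (auto elim: converges_mono)
      then show "Q x y" using rhs[rule_format, of "\<langle>x, \<langle>y, t + t'\<rangle>\<rangle>"] by simp
    qed
  qed (auto simp: accepted_def)
  moreover have "{i. \<forall>q. \<exists>z::nat. converges B (f i) (proj1 q) 1 (proj2 (proj2 q)) \<longrightarrow>
      converges B (f i) (proj1 (proj2 q)) 1 (proj2 (proj2 q)) \<longrightarrow> R i (proj1 q) (proj1 (proj2 q))}
      \<in> Sigma0 3 A"
    by (intro Sigma0_3_all_ex computable_intros decidable_converges assms(1)
        computable_comp[OF assms(2)] decidable3_comp[OF assms(3)])
  ultimately show ?thesis by simp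
qed

definition homogeneous_collection ::
    "nat set set \<Rightarrow> (nat set \<Rightarrow> nat \<Rightarrow> nat \<Rightarrow> bool) \<Rightarrow> (nat set \<Rightarrow> bool) \<Rightarrow> condition set" where
  "homogeneous_collection I M N =
     {p. ideal_condition I p \<and> (\<forall>x\<in>snd p. \<forall>y\<in>snd p. x \<le> y \<longrightarrow> M (fst p) x y) \<and> N (fst p)}"

lemma ideal_condition_indexed_iff:
  assumes "exact_pair I A0 A1" "valid_index A0 A1 i"
  shows "ideal_condition I (indexed_condition A0 i) \<longleftrightarrow> infinite (accepted A0 (proj1 (proj2 i))) \<and>
    (\<forall>d\<in>set_decode (proj1 i). \<forall>s\<in>accepted A0 (proj1 (proj2 i)). d < s)"
proof -
  have "accepted A0 (proj1 (proj2 i)) \<in> I"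
    using assms accepted_eq by (auto simp: exact_pair_def valid_index_def turing_le_def)
  then show ?thesis
    by (auto simp: ideal_condition_def mathias_condition_def indexed_condition_def)
qed

theorem Sigma0_homogeneous_collection:
  assumes exact: "exact_pair I A0 A1" and "n \<ge> 3"
    and decidable_M: "decidable3 (A0 \<oplus>\<^sub>T A1) (\<lambda>h. M (set_decode h))"
    and Sigma0_N: "{h. N (set_decode h)} \<in> Sigma0 n (A0 \<oplus>\<^sub>T A1)"
  shows "Sigma0_collection n I A0 A1 (homogeneous_collection I M N)"
proof -
  let ?A = "A0 \<oplus>\<^sub>T A1" and ?C = "homogeneous_collection I M N"
  let ?S = "\<lambda>i. accepted A0 (proj1 (proj2 i))"
  let ?R = "\<lambda>i x y. (\<forall>d\<in>set_decode (proj1 i). d < x) \<and> (x \<le> y \<longrightarrow> M (set_decode (proj1 i)) x y)"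
  have "condition_index A0 A1 i p \<longleftrightarrow> valid_index A0 A1 i \<and> p = indexed_condition A0 i"
    if "p \<in> ?C" for i p
    using that by (intro condition_index_iff)
      (auto simp: homogeneous_collection_def ideal_condition_def mathias_condition_def)
  then have "{i. \<exists>p\<in>?C. condition_index A0 A1 i p} =
      {i. valid_index A0 A1 i \<and> indexed_condition A0 i \<in> ?C}"
    by (intro Collect_cong) metis
  also have "\<dots> = {i. valid_index A0 A1 i} \<inter> ({i. infinite (?S i)} \<inter>
      ({i. \<forall>x\<in>?S i. \<forall>y\<in>?S i. ?R i x y} \<inter> {i. N (set_decode (proj1 i))}))"
    using ideal_condition_indexed_iff[OF exact]
    by (auto simp: homogeneous_collection_def indexed_condition_def)
  also have "\<dots> \<in> Sigma0 n ?A"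
  proof (intro Sigma0_Int)
    show "{i. valid_index A0 A1 i} \<in> Sigma0 n ?A"
      by (rule Sigma0_mono[OF \<open>n \<ge> 3\<close> Sigma0_3_valid_index])
    show "{i. infinite (?S i)} \<in> Sigma0 n ?A"
      by (intro Sigma0_mono[OF \<open>n \<ge> 3\<close>] Sigma0_3_infinite_accepted
          turing_le_join1 computable_intros)
    show "{i. \<forall>x\<in>?S i. \<forall>y\<in>?S i. ?R i x y} \<in> Sigma0 n ?A"
      by (intro Sigma0_mono[OF \<open>n \<ge> 3\<close>] Sigma0_3_all_accepted_pairs turing_le_join1
          computable_intros decidable3_comp[OF decidable_M])
    show "{i. N (set_decode (proj1 i))} \<in> Sigma0 n ?A"
      using Sigma0_vimage[OF Sigma0_N computable_proj1_id] by simp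
  qed
  finally show ?thesis by (auto simp: Sigma0_collection_def homogeneous_collection_def)
qed

section \<open>Computable conditions\<close>

abbreviation comp_condition :: "nat \<Rightarrow> condition" where
  "comp_condition \<equiv> indexed_condition {}"

definition comp_index :: "nat \<Rightarrow> bool" where
  "comp_index i \<longleftrightarrow> valid_index {} {} i \<and> ideal_condition COMP (comp_condition i)"

lemma condition_index_COMP_iff:
  assumes "ideal_condition COMP p"
  shows "condition_index {} {} i p \<longleftrightarrow> comp_index i \<and> p = comp_condition i"
proof -
  have "finite (fst p)" using assms by (auto simp: ideal_condition_def mathias_condition_def)
  from condition_index_iff[OF this] show ?thesis using assms by (auto simp: comp_index_def)
qed

lemma comp_index_if_computes:
  assumes "ideal_condition COMP (D, S)" "computes {} e S"
  shows "comp_index \<langle>set_encode D, \<langle>e, e\<rangle>\<rangle>" "comp_condition \<langle>set_encode D, \<langle>e, e\<rangle>\<rangle> = (D, S)"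
proof -
  have "condition_index {} {} \<langle>set_encode D, \<langle>e, e\<rangle>\<rangle> (D, S)"
    using assms(2) by (simp add: condition_index_def)
  then show "comp_index \<langle>set_encode D, \<langle>e, e\<rangle>\<rangle>" "comp_condition \<langle>set_encode D, \<langle>e, e\<rangle>\<rangle> = (D, S)"
    unfolding condition_index_COMP_iff[OF assms(1)] by simp_all
qed

lemma comp_index_exists:
  assumes "ideal_condition COMP p"
  obtains i where "comp_index i" "comp_condition i = p"
proof -
  obtain D S where p_eq: "p = (D, S)" by fastforce
  then obtain e where "computes {} e S"
    using assms by (auto simp: ideal_condition_def COMP_def turing_le_def)
  then show ?thesis using comp_index_if_computes assms that unfolding p_eq by blast
qed

lemma Sigma0_comp_indices:
  assumes "Sigma0_collection n COMP {} {} C"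
  shows "{i. comp_index i \<and> comp_condition i \<in> C} \<in> Sigma0 n {}"
proof -
  have "condition_index {} {} i p \<longleftrightarrow> comp_index i \<and> p = comp_condition i" if "p \<in> C" for i p
    using assms that by (intro condition_index_COMP_iff) (simp add: Sigma0_collection_def)
  then have "{i. comp_index i \<and> comp_condition i \<in> C} = {i. \<exists>p\<in>C. condition_index {} {} i p}"
    by (intro Collect_cong) metis
  then show ?thesis using assms by (simp add: Sigma0_collection_def empty_join_empty)
qed

lemma Sigma0_3_comp_index: "{i. comp_index i} \<in> Sigma0 3 {}"
proof -
  have "Sigma0_collection 3 COMP {} {} (homogeneous_collection COMP (\<lambda>_ _ _. True) (\<lambda>_. True))"
    by (intro Sigma0_homogeneous_collection exact_pair_COMP order_refl Sigma0_decidable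
        computable_intros)
  from Sigma0_comp_indices[OF this] show ?thesis
    by (rule back_subst[of "\<lambda>S. S \<in> Sigma0 3 {}"])
      (auto simp: homogeneous_collection_def comp_index_def)
qed

lemma extends_refl: "extends p p"
  by (cases p) (simp add: extends_def)

lemma extends_trans [trans]: "extends p q \<Longrightarrow> extends q r \<Longrightarrow> extends p r"
  by (cases p; cases q; cases r) (auto simp: extends_def)

lemma extends_chain:
  assumes "\<And>j. extends (p (Suc j)) (p j)" and "j \<le> k"
  shows "extends (p k) (p j)"
  using \<open>j \<le> k\<close>
proof (induction k rule: dec_induct)
  case base
  show ?case by (rule extends_refl)
next
  case (step k)
  then show ?case using assms(1) extends_trans by blast
qed

lemma satisfies_Union_chain:
  assumes chain: "\<And>j. extends (p (Suc j)) (p j)"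
  shows "satisfies (\<Union>k. fst (p k)) (p j)"
proof -
  have "fst (p k) \<subseteq> fst (p j) \<union> snd (p j)" for k
  proof (cases "k \<le> j")
    case True
    then show ?thesis using extends_chain[of p, OF chain True] by (auto simp: extends_def)
  next
    case False
    then show ?thesis using extends_chain[of p j k, OF chain] by (auto simp: extends_def)
  qed
  then show ?thesis unfolding satisfies_def by (auto simp: split_beta)
qed

lemma extends_comp_condition_iff:
  "extends (comp_condition j) (comp_condition i) \<longleftrightarrow>
     (\<forall>x. (x \<in> set_decode (proj1 i) \<longrightarrow> x \<in> set_decode (proj1 j)) \<and>
       (x \<in> set_decode (proj1 j) \<longrightarrow>
         x \<in> set_decode (proj1 i) \<or> x \<in> accepted {} (proj1 (proj2 i))) \<and>
       (x \<in> accepted {} (proj1 (proj2 j)) \<longrightarrow> x \<in> accepted {} (proj1 (proj2 i))))"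
  by (auto simp: extends_def indexed_condition_def)

section \<open>Generic sets in jump ideals\<close>

primrec universal :: "nat \<Rightarrow> nat \<Rightarrow> nat \<Rightarrow> bool" where
  "universal 0 e x \<longleftrightarrow> x \<in> accepted {} e"
| "universal (Suc n) e x \<longleftrightarrow> (\<exists>y. \<not> universal n e \<langle>x, y\<rangle>)"

lemma universal_complete:
  assumes "S \<in> Sigma0 n {}"
  obtains e where "S = {x. universal n e x}"
  using assms
proof (induction n arbitrary: S thesis)
  case 0
  then obtain e where "computes {} e S" by (auto simp: turing_le_def)
  then show ?case using 0(1)[of e] accepted_eq by simp
next
  case (Suc n)
  obtain P where S_projection: "P \<in> Sigma0 n {}" "\<And>x. x \<in> S \<longleftrightarrow> (\<exists>y. \<langle>x, y\<rangle> \<notin> P)"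
    using Suc.prems(2) by (rule Sigma0_SucE) blast
  obtain e where "P = {x. universal n e x}" using Suc.IH[OF _ S_projection(1)] by blast
  then show ?case using Suc.prems(1)[of e] S_projection(2) by auto
qed

definition universal_extension :: "nat \<Rightarrow> nat \<Rightarrow> nat \<Rightarrow> nat \<Rightarrow> bool" where
  "universal_extension n e i j \<longleftrightarrow>
     universal n e j \<and> comp_index j \<and> extends (comp_condition j) (comp_condition i)"

definition next_index :: "nat \<Rightarrow> nat \<Rightarrow> nat \<Rightarrow> nat" where
  "next_index n e i =
     (LEAST j. if \<exists>k. universal_extension n e i k then universal_extension n e i j else j = i)"

primrec generic_index :: "nat \<Rightarrow> nat \<Rightarrow> nat \<Rightarrow> nat" where
  "generic_index n i 0 = i"
| "generic_index n i (Suc e) = next_index n e (generic_index n i e)"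

definition generic_limit :: "nat \<Rightarrow> nat \<Rightarrow> nat set" where
  "generic_limit n i = (\<Union>e. fst (comp_condition (generic_index n i e)))"

lemma next_index_cases:
  "if \<exists>k. universal_extension n e i k then universal_extension n e i (next_index n e i)
   else next_index n e i = i"
  unfolding next_index_def by (rule LeastI_ex) auto

lemma comp_index_generic_index: "comp_index i \<Longrightarrow> comp_index (generic_index n i e)"
proof (induction e)
  case (Suc e)
  then show ?case
    using next_index_cases[of n e "generic_index n i e"]
    by (auto simp: universal_extension_def split: if_splits)
qed simp

lemma satisfies_generic_limit:
  "satisfies (generic_limit n i) (comp_condition (generic_index n i e))"
  unfolding generic_limit_def
proof (rule satisfies_Union_chain)
  fix e
  show "extends (comp_condition (generic_index n i (Suc e))) (comp_condition (generic_index n i e))"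
    using next_index_cases[of n e "generic_index n i e"]
    by (auto simp: universal_extension_def extends_refl split: if_splits)
qed

theorem mathias_generic_generic_limit:
  assumes comp_i: "comp_index i"
  shows "mathias_generic n COMP {} {} (generic_limit n i)"
  unfolding mathias_generic_def
proof (intro allI impI)
  fix C assume Sigma0_C: "Sigma0_collection n COMP {} {} C"
  obtain e where "{j. comp_index j \<and> comp_condition j \<in> C} = {j. universal n e j}"
    by (rule universal_complete[OF Sigma0_comp_indices[OF Sigma0_C]])
  then have universal_e: "comp_index j \<and> comp_condition j \<in> C \<longleftrightarrow> universal n e j" for j by blast
  let ?i = "generic_index n i e"
  show "meets (generic_limit n i) C \<or> avoids COMP (generic_limit n i) C"
  proof (cases "\<exists>k. universal_extension n e ?i k")
    case True
    then have "universal n e (generic_index n i (Suc e))"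
      using next_index_cases[of n e ?i] by (simp add: universal_extension_def)
    then have "meets (generic_limit n i) C"
      using universal_e satisfies_generic_limit unfolding meets_def by blast
    then show ?thesis ..
  next
    case False
    have "\<not> extends p (comp_condition ?i)" if "p \<in> C" for p
    proof -
      have "ideal_condition COMP p" using Sigma0_C that by (simp add: Sigma0_collection_def)
      then obtain k where "comp_index k" "comp_condition k = p" by (rule comp_index_exists)
      then show ?thesis using False universal_e that unfolding universal_extension_def by blast
    qed
    moreover have "ideal_condition COMP (comp_condition ?i)"
      using comp_index_generic_index[OF comp_i] by (simp add: comp_index_def)
    ultimately have "avoids COMP (generic_limit n i) C"
      using satisfies_generic_limit unfolding avoids_def by blast
    then show ?thesis ..
  qed
qed

definition projection :: "(nat \<Rightarrow> nat \<Rightarrow> bool) \<Rightarrow> nat set" where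
  "projection R = {x. \<exists>y. R x y}"

locale ideal =
  fixes I :: "nat set set"
  assumes ideal: "turing_ideal I"
begin

lemma mem_if_turing_le: "S \<in> I \<Longrightarrow> R \<le>\<^sub>T S \<Longrightarrow> R \<in> I"
  using ideal by (auto simp: turing_ideal_def)

lemma join_mem: "R \<in> I \<Longrightarrow> S \<in> I \<Longrightarrow> R \<oplus>\<^sub>T S \<in> I"
  using ideal by (auto simp: turing_ideal_def)

lemma Collect_mem: "S \<in> I \<Longrightarrow> decidable S P \<Longrightarrow> {x. P x} \<in> I"
  by (rule mem_if_turing_le) (simp_all add: turing_le_iff_decidable)

lemma computable_mem: "R \<le>\<^sub>T {} \<Longrightarrow> R \<in> I"
proof -
  assume computable_R: "R \<le>\<^sub>T {}"
  obtain S where "S \<in> I" using ideal by (auto simp: turing_ideal_def)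
  then show "R \<in> I" using mem_if_turing_le turing_le_trans[OF computable_R empty_turing_le] by blast
qed

lemma Collect_decidable: "decidable {} P \<Longrightarrow> {x. P x} \<in> I"
  by (rule computable_mem) (simp add: turing_le_iff_decidable)

lemma Collect_vimage: "S \<in> I \<Longrightarrow> computable {} f \<Longrightarrow> {x. f x \<in> S} \<in> I"
  by (rule Collect_mem[OF _ decidable_mem[OF turing_le_refl computable_mono[OF empty_turing_le]]])

lemma Collect_not: "{x. P x} \<in> I \<Longrightarrow> {x. \<not> P x} \<in> I"
  using Collect_mem[OF _ decidable_not[OF decidable_mem[OF turing_le_refl computable_id]]]
  by fastforce

lemma Collect_conj: "{x. P x} \<in> I \<Longrightarrow> {x. Q x} \<in> I \<Longrightarrow> {x. P x \<and> Q x} \<in> I"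
proof -
  assume "{x. P x} \<in> I" "{x. Q x} \<in> I"
  then have "{x. P x} \<oplus>\<^sub>T {x. Q x} \<in> I" by (rule join_mem)
  moreover have "decidable ({x. P x} \<oplus>\<^sub>T {x. Q x}) (\<lambda>x. x \<in> {x. P x} \<and> x \<in> {x. Q x})"
    by (intro computable_intros decidable_mem turing_le_join1 turing_le_join2)
  ultimately show ?thesis by (drule_tac Collect_mem) simp_all
qed

lemma Collect_disj: "{x. P x} \<in> I \<Longrightarrow> {x. Q x} \<in> I \<Longrightarrow> {x. P x \<or> Q x} \<in> I"
  using Collect_not[OF Collect_conj[OF Collect_not[of P] Collect_not[of Q]]] by simp

lemma Collect_imp: "{x. P x} \<in> I \<Longrightarrow> {x. Q x} \<in> I \<Longrightarrow> {x. P x \<longrightarrow> Q x} \<in> I"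
  unfolding imp_conv_disj by (intro Collect_disj Collect_not)

end

locale jump_ideal = ideal +
  assumes projection_closed: "B \<in> I \<Longrightarrow> decidable2 B R \<Longrightarrow> projection R \<in> I"
begin

lemma Collect_ex:
  assumes "{p. P (proj1 p) (proj2 p)} \<in> I" (is "?P \<in> I")
  shows "{x. \<exists>y. P x y} \<in> I"
proof -
  have "decidable ?P (\<lambda>p. p \<in> ?P)" by (intro decidable_mem turing_le_refl computable_id)
  then show ?thesis using projection_closed[OF assms, of P] by (simp add: projection_def)
qed

lemma Collect_all: "{p. P (proj1 p) (proj2 p)} \<in> I \<Longrightarrow> {x. \<forall>y. P x y} \<in> I"
  using Collect_not[OF Collect_ex[OF Collect_not[of "\<lambda>p. P (proj1 p) (proj2 p)"]]] by simp

lemma Sigma0_mem: "B \<in> I \<Longrightarrow> S \<in> Sigma0 n B \<Longrightarrow> S \<in> I"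
proof (induction n arbitrary: S)
  case 0
  then show ?case using mem_if_turing_le by simp
next
  case (Suc n)
  obtain P where "P \<in> Sigma0 n B" and S_eq: "S = {x. \<exists>y. \<langle>x, y\<rangle> \<notin> P}"
    using Suc.prems(2) by auto
  then have "{p. p \<notin> P} \<in> I" using Suc.IH Suc.prems(1) by (intro Collect_not) simp
  then show ?case unfolding S_eq by (intro Collect_ex) simp
qed

lemma Collect_accepted:
  assumes "computable {} f" "computable {} g"
  shows "{x. f x \<in> accepted {} (g x)} \<in> I"
  unfolding accepted_def mem_Collect_eq
  by (intro Collect_ex Collect_decidable decidable_converges turing_le_refl computable_intros
      computable_comp[OF assms(1)] computable_comp[OF assms(2)])

lemma Collect_universal:
  "computable {} f \<Longrightarrow> computable {} g \<Longrightarrow> {p. universal n (f p) (g p)} \<in> I"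
proof (induction n arbitrary: f g)
  case 0
  then show ?case by (simp add: Collect_accepted)
next
  case (Suc n)
  show ?case
    unfolding universal.simps
    by (intro Collect_ex Collect_not Suc.IH computable_intros
        computable_comp[OF Suc.prems(1)] computable_comp[OF Suc.prems(2)])
qed

lemma Collect_universal_extension:
  "{p. universal_extension n (proj1 (proj1 p)) (proj2 (proj1 p)) (proj2 p)} \<in> I"
  unfolding universal_extension_def extends_comp_condition_iff
proof (intro Collect_conj)
  have "{i. comp_index i} \<in> I"
    by (rule Sigma0_mem[OF computable_mem[OF turing_le_refl] Sigma0_3_comp_index])
  from Collect_vimage[OF this computable_proj2_id] show "{p. comp_index (proj2 p)} \<in> I" by simp
qed (intro Collect_universal Collect_all Collect_conj Collect_imp Collect_disj Collect_accepted
    computable_intros | intro Collect_decidable computable_intros)+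

lemma generic_limit_mem: "generic_limit n i \<in> I"
proof -
  let ?U = "{p. universal_extension n (proj1 (proj1 p)) (proj2 (proj1 p)) (proj2 p)}"
  let ?E = "{p. \<exists>k. universal_extension n (proj1 p) (proj2 p) k}"
  let ?Z = "?U \<oplus>\<^sub>T ?E"
  have "?Z \<in> I" by (intro join_mem Collect_ex Collect_universal_extension)
  have "computable2 ?Z (next_index n)"
    unfolding next_index_def
  proof (intro computable_Least decidable_if)
    have "decidable ?Z (\<lambda>p. p \<in> ?U)" by (intro decidable_mem turing_le_join1 computable_id)
    then show "decidable ?Z
        (\<lambda>p. universal_extension n (proj1 (proj1 p)) (proj2 (proj1 p)) (proj2 p))"
      by simp
    have "decidable ?Z (\<lambda>p. proj1 p \<in> ?E)"
      by (intro decidable_mem turing_le_join2 computable_intros)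
    then show "decidable ?Z (\<lambda>p. \<exists>k. universal_extension n (proj1 (proj1 p)) (proj2 (proj1 p)) k)"
      by simp
    show "\<exists>j. if \<exists>k. universal_extension n (proj1 p) (proj2 p) k
        then universal_extension n (proj1 p) (proj2 p) j else j = proj2 p" for p
      by auto
  qed (intro computable_intros)+
  then have "computable3 ?Z (\<lambda>x e j. next_index n e j)"
    by (rule computable2_comp[where h = "next_index n"]) (intro computable_intros)+
  then have generic_index: "computable ?Z (generic_index n i)"
    by (rule computable_primrec[where F = "\<lambda>x. generic_index n i" and n = "\<lambda>e. e", rotated 2])
      (simp_all add: computable_const computable_id)
  have "decidable ?Z (\<lambda>p. proj1 p \<in> set_decode (proj1 (generic_index n i (proj2 p))))"
    by (intro computable_intros computable_comp[OF generic_index])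
  then have "{x. \<exists>e. x \<in> set_decode (proj1 (generic_index n i e))} \<in> I"
    by (intro Collect_ex Collect_mem[OF \<open>?Z \<in> I\<close>])
  then show ?thesis
    by (rule back_subst[of "\<lambda>S. S \<in> I"]) (auto simp: generic_limit_def indexed_condition_def)
qed

theorem ex_COMP_generic: "\<exists>H\<in>I. mathias_generic n COMP {} {} H"
proof -
  have "UNIV \<le>\<^sub>T {}" by (simp add: turing_le_iff_decidable decidable_const)
  then have "ideal_condition COMP ({}, UNIV)"
    by (simp add: ideal_condition_def mathias_condition_def COMP_def)
  then obtain i where "comp_index i" by (rule comp_index_exists)
  then show ?thesis using generic_limit_mem mathias_generic_generic_limit by blast
qed

end

section \<open>Conditions with reservoirs in an ideal\<close>

context ideal
begin

definition ideal_extends :: "condition \<Rightarrow> condition \<Rightarrow> bool" (infix "\<preceq>" 50) where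
  "q \<preceq> p \<longleftrightarrow> ideal_condition I q \<and> extends q p"

lemma ideal_extends_trans [trans]: "r \<preceq> q \<Longrightarrow> q \<preceq> p \<Longrightarrow> r \<preceq> p"
  unfolding ideal_extends_def using extends_trans by blast

lemma ideal_extends_refl: "ideal_condition I p \<Longrightarrow> p \<preceq> p"
  by (simp add: ideal_extends_def extends_refl)

lemma ideal_extends_imp_condition: "q \<preceq> p \<Longrightarrow> ideal_condition I q"
  by (simp add: ideal_extends_def)

lemma ideal_conditionD:
  assumes "ideal_condition I p"
  shows "finite (fst p)" "infinite (snd p)" "snd p \<in> I"
    "d \<in> fst p \<Longrightarrow> s \<in> snd p \<Longrightarrow> d < s"
  using assms by (auto simp: ideal_condition_def mathias_condition_def)

lemma ideal_condition_unbounded: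
  "ideal_condition I p \<Longrightarrow> \<exists>y\<in>snd p. m \<le> y"
  using ideal_conditionD(2)[of p] by (simp add: infinite_nat_iff_unbounded_le Bex_def conj_commute)

lemma ideal_extends_subset:
  assumes "ideal_condition I p" "S \<subseteq> snd p" "infinite S" "S \<in> I"
  shows "(fst p, S) \<preceq> p"
  using assms
  by (cases p) (auto simp: ideal_extends_def ideal_condition_def mathias_condition_def extends_def)

lemma reservoir_tail:
  assumes cond: "ideal_condition I p"
  shows "infinite {z \<in> snd p. m < z}" "{z \<in> snd p. m < z} \<in> I"
proof -
  have "snd p - {..m} = {z \<in> snd p. m < z}" by auto
  then show "infinite {z \<in> snd p. m < z}"
    using Diff_infinite_finite[OF finite_atMost ideal_conditionD(2)[OF cond], of m] by simp
  show "{z \<in> snd p. m < z} \<in> I"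
    by (intro Collect_mem[OF ideal_conditionD(3)[OF cond]] computable_intros decidable_mem
        turing_le_refl)
qed

definition adjoin :: "nat \<Rightarrow> condition \<Rightarrow> condition" where
  "adjoin y p = (insert y (fst p), {z \<in> snd p. y < z})"

lemma adjoin_sel: "fst (adjoin y p) = insert y (fst p)" "snd (adjoin y p) = {z \<in> snd p. y < z}"
  by (simp_all add: adjoin_def)

lemma adjoin_extends:
  assumes "ideal_condition I p" "y \<in> snd p"
  shows "adjoin y p \<preceq> p"
  using assms ideal_conditionD[OF assms(1)] reservoir_tail[OF assms(1)]
  by (cases p) (auto simp: ideal_extends_def adjoin_def ideal_condition_def mathias_condition_def
      extends_def)

end

context
  fixes P :: "nat \<Rightarrow> nat \<Rightarrow> bool" and S :: "nat set" and q :: nat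
begin

primrec greedy_last :: "nat \<Rightarrow> nat" where
  "greedy_last 0 = q"
| "greedy_last (Suc k) =
     (if k \<in> S \<and> greedy_last k < k \<and> P (greedy_last k) k then k else greedy_last k)"

definition greedy_subset :: "nat set" where
  "greedy_subset = {k \<in> S. greedy_last k < k \<and> P (greedy_last k) k}"

lemma greedy_last_Suc:
  "greedy_last (Suc k) = (if k \<in> greedy_subset then k else greedy_last k)"
  by (simp add: greedy_subset_def)

lemma greedy_last_mono: "k \<le> l \<Longrightarrow> greedy_last k \<le> greedy_last l"
  by (rule lift_Suc_mono_le[of greedy_last]) auto

lemma greedy_subset_subset: "greedy_subset \<subseteq> S"
  by (auto simp: greedy_subset_def)

lemma greedy_subset_homogeneous:
  assumes antimono: "\<And>x x' y. P x y \<Longrightarrow> x' \<le> x \<Longrightarrow> P x' y"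
  shows "y \<in> greedy_subset \<Longrightarrow> q < y \<and> P q y"
    and "x \<in> greedy_subset \<Longrightarrow> y \<in> greedy_subset \<Longrightarrow> x < y \<Longrightarrow> P x y"
proof -
  assume mem_y: "y \<in> greedy_subset"
  have "q \<le> greedy_last y" using greedy_last_mono[of 0 y] by simp
  then show "q < y \<and> P q y" using mem_y antimono by (auto simp: greedy_subset_def)
  assume "x \<in> greedy_subset" "x < y"
  then have "x \<le> greedy_last y" using greedy_last_mono[of "Suc x" y]
    by (simp add: greedy_last_Suc del: greedy_last.simps)
  then show "P x y" using mem_y antimono by (auto simp: greedy_subset_def)
qed

lemma infinite_greedy_subset:
  assumes "infinite S" and eventually_P: "\<And>x. \<exists>t. \<forall>y\<ge>t. P x y"
  shows "infinite greedy_subset"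
proof
  assume "finite greedy_subset"
  then obtain N where bounded: "\<And>k. k \<in> greedy_subset \<Longrightarrow> k < N"
    by (auto simp: finite_nat_set_iff_bounded)
  have const: "greedy_last (N + k) = greedy_last N" for k
  proof (induction k)
    case (Suc k)
    have "N + k \<notin> greedy_subset" using bounded[of "N + k"] by auto
    then show ?case using Suc by (simp add: greedy_last_Suc del: greedy_last.simps)
  qed simp
  obtain t where P_after_t: "\<And>y. y \<ge> t \<Longrightarrow> P (greedy_last N) y" using eventually_P by blast
  obtain y where y_large: "y \<in> S" "y \<ge> t + N + Suc (greedy_last N)"
    using \<open>infinite S\<close> by (meson infinite_nat_iff_unbounded_le)
  then have "greedy_last y = greedy_last N" using const[of "y - N"] by simp
  then have "y \<in> greedy_subset" using y_large P_after_t by (simp add: greedy_subset_def)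
  then show False using bounded[of y] y_large(2) by simp
qed

lemma greedy_subset_turing_le:
  assumes decidable_P: "decidable2 C P" and S_le: "S \<le>\<^sub>T C"
  shows "greedy_subset \<le>\<^sub>T C"
proof -
  have "computable C greedy_last"
  proof (rule computable_primrec[where F = "\<lambda>x. greedy_last" and n = "\<lambda>k. k", rotated 2])
    show "computable3 C (\<lambda>x k l. if k \<in> S \<and> l < k \<and> P l k then k else l)"
      by (intro computable_intros decidable_mem[OF S_le] decidable2_comp[OF decidable_P])
  qed (simp_all add: computable_const computable_id)
  then show ?thesis
    unfolding turing_le_iff_decidable greedy_subset_def mem_Collect_eq
    by (intro computable_intros decidable_mem[OF S_le] decidable2_comp[OF decidable_P])
qed

end

lemma (in ideal) obtain_homogeneous_subset:
  assumes reservoir: "S \<in> I" "infinite S" and decidable_P: "X \<in> I" "decidable2 X P"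
    and antimono: "\<And>x x' y. P x y \<Longrightarrow> x' \<le> x \<Longrightarrow> P x' y"
    and eventually_P: "\<And>x. \<exists>t. \<forall>y\<ge>t. P x y"
  obtains S' where "S' \<subseteq> S" "infinite S'" "S' \<in> I" "\<forall>y\<in>S'. q < y \<and> P q y"
    "\<forall>x\<in>S'. \<forall>y\<in>S'. x < y \<longrightarrow> P x y"
proof
  let ?S' = "greedy_subset P S q"
  show "?S' \<subseteq> S" by (rule greedy_subset_subset)
  show "infinite ?S'" by (rule infinite_greedy_subset[OF reservoir(2) eventually_P])
  have "?S' \<le>\<^sub>T S \<oplus>\<^sub>T X"
    by (intro greedy_subset_turing_le turing_le_join1
        decidable_mono[OF turing_le_join2 decidable_P(2)])
  then show "?S' \<in> I" by (rule mem_if_turing_le[OF join_mem[OF reservoir(1) decidable_P(1)]])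
  show "\<forall>y\<in>?S'. q < y \<and> P q y" using greedy_subset_homogeneous(1)[of P] antimono by blast
  show "\<forall>x\<in>?S'. \<forall>y\<in>?S'. x < y \<longrightarrow> P x y"
    using greedy_subset_homogeneous(2)[of P] antimono by blast
qed

section \<open>Settling times\<close>

lemma uniform_bound:
  fixes P :: "'a \<Rightarrow> nat \<Rightarrow> bool"
  assumes "finite X" "\<And>x t t'. P x t \<Longrightarrow> t \<le> t' \<Longrightarrow> P x t'" "\<And>x. x \<in> X \<Longrightarrow> \<exists>t. P x t"
  shows "\<exists>t. \<forall>x\<in>X. P x t"
proof -
  from assms(3) obtain f where P_f: "\<And>x. x \<in> X \<Longrightarrow> P x (f x)" by metis
  have "P x (sum f X)" if "x \<in> X" for x
    using assms(2)[OF P_f[OF that]] member_le_sum[of x X f] that assms(1) by simp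
  then show ?thesis by blast
qed

definition settled_by :: "(nat \<Rightarrow> nat \<Rightarrow> bool) \<Rightarrow> nat \<Rightarrow> nat \<Rightarrow> bool" where
  "settled_by R x y \<longleftrightarrow> (\<forall>u<x. u \<in> projection R \<longrightarrow> (\<exists>t<y. R u t))"

lemma settled_by_mono: "settled_by R x y \<Longrightarrow> x' \<le> x \<Longrightarrow> y \<le> y' \<Longrightarrow> settled_by R x' y'"
  unfolding settled_by_def by (meson less_le_trans)

lemma eventually_settled_by: "\<exists>t. \<forall>y\<ge>t. settled_by R x y"
proof -
  have "\<exists>t. \<forall>u\<in>{..<x}. u \<in> projection R \<longrightarrow> (\<exists>s<t. R u s)"
  proof (rule uniform_bound)
    show "\<exists>t. u \<in> projection R \<longrightarrow> (\<exists>s<t. R u s)" for u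
      unfolding projection_def by blast
    show "u \<in> projection R \<longrightarrow> (\<exists>s<t'. R u s)"
      if "u \<in> projection R \<longrightarrow> (\<exists>s<t. R u s)" "t \<le> t'" for u t t'
      using that less_le_trans by blast
  qed simp
  then obtain t where "settled_by R x t" by (auto simp: settled_by_def)
  then show ?thesis using settled_by_mono by blast
qed

lemma decidable_settled_by:
  assumes "decidable2 C R" "projection R \<le>\<^sub>T C"
  shows "decidable2 C (settled_by R)"
  unfolding settled_by_def
  by (intro computable_intros decidable_mem[OF assms(2)] decidable2_comp[OF assms(1)])

text \<open>
  A number \<open>u\<close> outside the projection is recognised from \<open>x < y\<close> in \<open>S\<close> above \<open>u\<close> such that no
  witness for \<open>u\<close> has appeared before \<open>y\<close>.
\<close>

lemma projection_turing_le_if_settled: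
  assumes decidable_R: "decidable2 C R" and settling_set: "S \<le>\<^sub>T C" "infinite S"
    and settled: "\<And>x y. x \<in> S \<Longrightarrow> y \<in> S \<Longrightarrow> x < y \<Longrightarrow> settled_by R x y"
  shows "projection R \<le>\<^sub>T C"
  unfolding turing_le_iff_decidable
proof (rule decidable_if_semidecidable)
  define excluded where "excluded u z \<longleftrightarrow> u < proj1 z \<and> proj1 z < proj2 z \<and>
    proj1 z \<in> S \<and> proj2 z \<in> S \<and> \<not> (\<exists>t<proj2 z. R u t)" for u z
  show "decidable2 C R" by (rule decidable_R)
  show "decidable2 C excluded"
    unfolding excluded_def
    by (intro computable_intros decidable_mem[OF settling_set(1)] decidable2_comp[OF decidable_R])
  show "u \<in> projection R \<longleftrightarrow> (\<exists>t. R u t)" for u by (simp add: projection_def)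
  show "u \<notin> projection R \<longleftrightarrow> (\<exists>z. excluded u z)" for u
  proof
    assume "u \<notin> projection R"
    moreover obtain x where "x \<in> S" "u < x" using settling_set(2)
      by (meson infinite_nat_iff_unbounded)
    moreover obtain y where "y \<in> S" "x < y" using settling_set(2)
      by (meson infinite_nat_iff_unbounded)
    ultimately have "excluded u \<langle>x, y\<rangle>" by (simp add: excluded_def projection_def)
    then show "\<exists>z. excluded u z" ..
  next
    assume "\<exists>z. excluded u z"
    then obtain z where excluded: "excluded u z" ..
    then have "settled_by R (proj1 z) (proj2 z)" by (intro settled) (simp_all add: excluded_def)
    then show "u \<notin> projection R" using excluded by (auto simp: excluded_def settled_by_def)
  qed
qed

lemma turing_le_Diff_finite: "finite D \<Longrightarrow> X - D \<le>\<^sub>T X"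
proof -
  assume "finite D"
  moreover have "decidable X (\<lambda>x. x \<in> X \<and> x \<notin> set_decode (set_encode D))"
    by (intro computable_intros decidable_mem turing_le_refl)
  ultimately show ?thesis by (simp add: turing_le_iff_decidable)
qed

section \<open>Generic sets\<close>

locale generic_set = ideal +
  fixes A0 A1 G :: "nat set" and n :: nat
  assumes exact: "exact_pair I A0 A1" and n_ge_3: "n \<ge> 3" and generic: "mathias_generic n I A0 A1 G"
begin

lemma turing_le_exact_pair: "S \<in> I \<Longrightarrow> S \<le>\<^sub>T A0 \<oplus>\<^sub>T A1"
  using exact turing_le_trans[OF _ turing_le_join1] by (auto simp: exact_pair_def)

lemma generic_meets_dense:
  assumes "Sigma0_collection n I A0 A1 C"
    and dense: "\<And>p. ideal_condition I p \<Longrightarrow> \<exists>q\<in>C. extends q p"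
  obtains p where "p \<in> C" "satisfies G p"
proof -
  have "\<not> avoids I G C" using dense unfolding avoids_def by blast
  then show ?thesis using assms(1) generic that unfolding mathias_generic_def meets_def by blast
qed

lemma infinite_generic: "infinite G"
  unfolding infinite_nat_iff_unbounded_le
proof
  fix m
  let ?C = "homogeneous_collection I (\<lambda>_ _ _. True) (\<lambda>D. \<exists>d\<in>D. m \<le> d)"
  have "Sigma0_collection n I A0 A1 ?C"
    by (intro Sigma0_homogeneous_collection exact n_ge_3 Sigma0_decidable computable_intros)
  moreover have "\<exists>q\<in>?C. extends q p" if cond: "ideal_condition I p" for p
  proof -
    obtain y where "y \<in> snd p" "m \<le> y" using ideal_condition_unbounded[OF cond] by blast
    then have "adjoin y p \<in> ?C" "extends (adjoin y p) p"
      using adjoin_extends[OF cond]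
      by (auto simp: homogeneous_collection_def adjoin_def ideal_extends_def)
    then show ?thesis ..
  qed
  ultimately obtain p where "p \<in> ?C" "satisfies G p" by (rule generic_meets_dense)
  then show "\<exists>k\<ge>m. k \<in> G" by (auto simp: homogeneous_collection_def satisfies_def)
qed

theorem generic_computes_projection:
  assumes B_below: "B \<in> I" "B \<le>\<^sub>T G" and decidable_R: "decidable2 B R"
    and projection_mem: "projection R \<in> I"
  shows "projection R \<le>\<^sub>T G"
proof -
  let ?X = "projection R \<oplus>\<^sub>T B"
  let ?C = "homogeneous_collection I (\<lambda>D x y. x < y \<longrightarrow> settled_by R x y) (\<lambda>D. True)"
  have X_mem: "?X \<in> I" by (rule join_mem[OF projection_mem B_below(1)])
  have settled: "decidable2 ?X (settled_by R)"
    by (intro decidable_settled_by decidable_mono[OF turing_le_join2 decidable_R] turing_le_join1)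
  have "Sigma0_collection n I A0 A1 ?C"
    by (intro Sigma0_homogeneous_collection exact n_ge_3 Sigma0_decidable computable_intros
        decidable2_comp[OF decidable_mono[OF turing_le_exact_pair[OF X_mem] settled]])
  moreover have "\<exists>q\<in>?C. extends q p" if cond: "ideal_condition I p" for p
  proof -
    obtain S' where homogeneous: "S' \<subseteq> snd p" "infinite S'" "S' \<in> I"
      "\<forall>x\<in>S'. \<forall>y\<in>S'. x < y \<longrightarrow> settled_by R x y"
      using settled_by_mono[OF _ _ order_refl]
      by (rule obtain_homogeneous_subset[OF ideal_conditionD(3,2)[OF cond] X_mem settled _
            eventually_settled_by, where q = 0]) blast
    then have "(fst p, S') \<preceq> p" by (intro ideal_extends_subset cond)
    then show ?thesis using homogeneous(4) unfolding ideal_extends_def homogeneous_collection_def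
      by (intro bexI[of _ "(fst p, S')"]) auto
  qed
  ultimately obtain p where generic_p: "p \<in> ?C" "satisfies G p" by (rule generic_meets_dense)
  then have "ideal_condition I p" by (auto simp: homogeneous_collection_def)
  then have "finite (fst p)" by (rule ideal_conditionD)
  show ?thesis
  proof (rule projection_turing_le_if_settled)
    show "decidable2 G R" by (rule decidable_mono[OF B_below(2) decidable_R])
    show "G - fst p \<le>\<^sub>T G" using \<open>finite (fst p)\<close> by (rule turing_le_Diff_finite)
    show "infinite (G - fst p)" using infinite_generic \<open>finite (fst p)\<close> by simp
    show "settled_by R x y" if "x \<in> G - fst p" "y \<in> G - fst p" "x < y" for x y
    proof -
      have "x \<in> snd p" "y \<in> snd p" using generic_p(2) that by (auto simp: satisfies_def)
      then show ?thesis using generic_p(1) that(3) by (simp add: homogeneous_collection_def)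
    qed
  qed
qed

lemma turing_ideal_below_generic: "turing_ideal {S \<in> I. S \<le>\<^sub>T G}"
  unfolding turing_ideal_def
proof (intro conjI ballI allI impI)
  show "{S \<in> I. S \<le>\<^sub>T G} \<noteq> {}" using computable_mem[OF turing_le_refl] empty_turing_le by blast
  show "countable {S \<in> I. S \<le>\<^sub>T G}"
    using ideal by (auto simp: turing_ideal_def intro: countable_subset[of _ I])
qed (auto intro: mem_if_turing_le turing_le_trans join_mem turing_join_le)

lemma satisfied_conditions_compatible:
  assumes cond_p: "ideal_condition I p" "satisfies G p"
    and cond_q: "ideal_condition I q" "satisfies G q"
    and "fst q \<subseteq> fst p"
  shows "(fst p, snd p \<inter> snd q) \<preceq> p" "(fst p, snd p \<inter> snd q) \<preceq> q"
proof -
  have "infinite (G - (fst p \<union> fst q))"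
    using infinite_generic ideal_conditionD(1)[OF cond_p(1)] ideal_conditionD(1)[OF cond_q(1)]
    by simp
  moreover have "G - (fst p \<union> fst q) \<subseteq> snd p \<inter> snd q"
    using cond_p(2) cond_q(2) by (auto simp: satisfies_def)
  ultimately have "infinite (snd p \<inter> snd q)" using finite_subset by blast
  moreover have "snd p \<inter> snd q \<in> I"
    using Collect_conj[of "\<lambda>x. x \<in> snd p" "\<lambda>x. x \<in> snd q"] ideal_conditionD(3) cond_p(1) cond_q(1)
    by (simp add: Int_def)
  ultimately show extends_p: "(fst p, snd p \<inter> snd q) \<preceq> p"
    using cond_p(1) by (intro ideal_extends_subset) simp_all
  then show "(fst p, snd p \<inter> snd q) \<preceq> q"
    using cond_p(2) cond_q(2) \<open>fst q \<subseteq> fst p\<close>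
    by (auto simp: ideal_extends_def extends_def satisfies_def)
qed

end

section \<open>Stacks of programs\<close>

lemma list_decode_tl: "list_decode (proj2 (s - 1)) = tl (list_decode s)"
  by (cases s) (simp, simp add: proj2_def split: prod.split)

lemma hd_list_decode: "list_decode s \<noteq> [] \<Longrightarrow> hd (list_decode s) = proj1 (s - 1)"
  by (cases s) (auto simp: proj1_def split: prod.split)

lemma list_decode_eq_Nil_iff: "list_decode s = [] \<longleftrightarrow> s = 0"
  by (cases s) (auto split: prod.split)

lemma length_list_decode_le: "length (list_decode s) \<le> s"
proof -
  have "length xs \<le> list_encode xs" for xs
  proof (induction xs)
    case (Cons x xs)
    have "list_encode xs \<le> \<langle>x, list_encode xs\<rangle>" by (rule le_prod_encode_2)
    then show ?case using Cons by simp
  qed simp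
  from this[of "list_decode s"] show ?thesis by simp
qed

lemma Ball_list_decode_iff:
  defines "tail \<equiv> \<lambda>s. proj2 (s - 1)"
  shows "(\<forall>b\<in>set (list_decode s). P b) \<longleftrightarrow> (\<forall>k<s. (tail ^^ k) s \<noteq> 0 \<longrightarrow> P (proj1 ((tail ^^ k) s - 1)))"
proof -
  have "list_decode (tail u) = tl (list_decode u)" for u
    unfolding tail_def by (rule list_decode_tl)
  then have drop: "list_decode ((tail ^^ k) s) = drop k (list_decode s)" for k
    by (induction k) (simp_all add: drop_Suc tl_drop)
  have nonempty: "(tail ^^ k) s \<noteq> 0 \<longleftrightarrow> k < length (list_decode s)" for k
    using list_decode_eq_Nil_iff[of "(tail ^^ k) s"] by (auto simp: drop)
  have nth: "proj1 ((tail ^^ k) s - 1) = list_decode s ! k" if "k < length (list_decode s)" for k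
    using hd_list_decode[of "(tail ^^ k) s"] that by (simp add: drop hd_drop_conv_nth)
  have "(\<forall>b\<in>set (list_decode s). P b) \<longleftrightarrow> (\<forall>k<s. k < length (list_decode s) \<longrightarrow> P (list_decode s ! k))"
    using length_list_decode_le[of s] by (auto simp: all_set_conv_all_nth)
  also have "\<dots> \<longleftrightarrow> (\<forall>k<s. (tail ^^ k) s \<noteq> 0 \<longrightarrow> P (proj1 ((tail ^^ k) s - 1)))"
    using nonempty nth by auto
  finally show ?thesis .
qed

lemma decidable_Ball_list_decode [computable_intros]:
  assumes "decidable2 A P" "computable A f"
  shows "decidable A (\<lambda>x. \<forall>b\<in>set (list_decode (f x)). P x b)"
  unfolding Ball_list_decode_iff
  by (intro computable_intros computable_comp[OF assms(2)] decidable2_comp[OF assms(1)] assms(2))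

definition stack_set :: "nat list \<Rightarrow> nat set" where
  "stack_set s = (\<Inter>e\<in>set s. accepted {} e)"

definition confirmed :: "nat list \<Rightarrow> nat \<Rightarrow> nat \<Rightarrow> bool" where
  "confirmed s y t \<longleftrightarrow> (\<forall>e\<in>set s. converges {} e y 1 t)"

definition verified :: "nat list \<Rightarrow> nat \<Rightarrow> nat \<Rightarrow> bool" where
  "verified s x t \<longleftrightarrow>
     (\<forall>e\<in>set s. \<forall>y\<le>x. \<exists>v<2. converges {} e y v t) \<and> (\<exists>y\<le>t. x < y \<and> confirmed s y t)"

definition genuine :: "nat list \<Rightarrow> bool" where
  "genuine s \<longleftrightarrow> (\<forall>e\<in>set s. \<exists>S. computes {} e S) \<and> infinite (stack_set s)"

lemma confirmed_mono: "confirmed s y t \<Longrightarrow> t \<le> t' \<Longrightarrow> confirmed s y t'"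
  unfolding confirmed_def using converges_mono by blast

lemma verified_mono:
  assumes "verified s x t" "x' \<le> x" "t \<le> t'"
  shows "verified s x' t'"
proof -
  have "\<exists>v<2. converges {} e y v t'" if "e \<in> set s" "y \<le> x'" for e y
    using assms that converges_mono unfolding verified_def by (meson le_trans)
  moreover obtain y where "y \<le> t" "x < y" "confirmed s y t"
    using assms(1) unfolding verified_def by blast
  then have "\<exists>y\<le>t'. x' < y \<and> confirmed s y t'" using assms(2,3) confirmed_mono
    by (intro exI[of _ y]) auto
  ultimately show ?thesis unfolding verified_def by blast
qed

lemma mem_stack_set_iff: "y \<in> stack_set s \<longleftrightarrow> (\<exists>t. confirmed s y t)"
proof
  assume "y \<in> stack_set s"
  then show "\<exists>t. confirmed s y t"
    unfolding confirmed_def stack_set_def accepted_def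
    by (intro uniform_bound) (auto intro: converges_mono)
qed (auto simp: confirmed_def stack_set_def accepted_def)

lemma verified_if_genuine:
  assumes genuine_s: "genuine s"
  shows "\<exists>t. verified s x t"
proof -
  have "\<exists>t. \<exists>v<2. converges {} e y v t" if program: "e \<in> set s" for e y
  proof -
    obtain S where "computes {} e S" using genuine_s program by (auto simp: genuine_def)
    then obtain t where "converges {} e y (char_fun S y) t"
      using ex_converges_computes_iff by blast
    moreover have "char_fun S y < 2" by (simp add: char_fun_def)
    ultimately show ?thesis by blast
  qed
  then have "\<exists>t. \<forall>(e, y)\<in>set s \<times> {..x}. \<exists>v<2. converges {} e y v t"
    by (intro uniform_bound) (auto intro: converges_mono)
  then obtain t where decided_by_t: "\<And>e y. e \<in> set s \<Longrightarrow> y \<le> x \<Longrightarrow> \<exists>v<2. converges {} e y v t" by auto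
  obtain y where "x < y" "y \<in> stack_set s"
    using genuine_s by (auto simp: genuine_def infinite_nat_iff_unbounded)
  then obtain t' where "confirmed s y t'" by (auto simp: mem_stack_set_iff)
  have "\<exists>v<2. converges {} e z v (t + t' + y)" if "e \<in> set s" "z \<le> x" for e z
    using decided_by_t[OF that] converges_mono[of "{}" e z _ t "t + t' + y"] by auto
  moreover have "confirmed s y (t + t' + y)" using \<open>confirmed s y t'\<close> by (rule confirmed_mono) simp
  ultimately have "verified s x (t + t' + y)"
    using \<open>x < y\<close> unfolding verified_def by (auto intro!: exI[of _ y])
  then show ?thesis ..
qed

lemma genuine_if_verified:
  assumes verified_s: "\<And>x. \<exists>t. verified s x t"
  shows "genuine s"
proof -
  have "\<exists>S. computes {} e S" if program: "e \<in> set s" for e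
  proof -
    have "\<exists>v. v < 2 \<and> (\<exists>t. converges {} e y v t)" for y
      using verified_s[of y] program unfolding verified_def by blast
    then obtain f where "\<And>y. f y < 2" "\<And>y. \<exists>t. converges {} e y (f y) t" by metis
    then show ?thesis using computes_if_converges[of f] by blast
  qed
  moreover have "infinite (stack_set s)"
    unfolding infinite_nat_iff_unbounded using verified_s mem_stack_set_iff unfolding verified_def
    by blast
  ultimately show "genuine s" by (simp add: genuine_def)
qed

lemma genuine_Cons:
  assumes "genuine s" "computes {} e S" "infinite S" "S \<subseteq> stack_set s"
  shows "genuine (e # s)"
proof -
  have "stack_set (e # s) = S"
    using assms(4) accepted_eq[OF assms(2)] by (auto simp: stack_set_def)
  then show ?thesis using assms by (auto simp: genuine_def)
qed

lemma genuine_computable: "genuine s \<Longrightarrow> stack_set s \<le>\<^sub>T {}"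
proof -
  assume "genuine s"
  then have "\<forall>e\<in>set s. \<exists>S. computes {} e S" by (simp add: genuine_def)
  then have "decidable {} (\<lambda>y. \<forall>e\<in>set s. y \<in> accepted {} e)"
  proof (induction s)
    case (Cons e s)
    then obtain S where "computes {} e S" by auto
    then have "accepted {} e \<le>\<^sub>T {}" using accepted_eq by (auto simp: turing_le_def)
    then show ?case using Cons
      by (simp only: list.set ball_simps) (intro decidable_conj decidable_mem computable_id; simp)
  qed (simp add: decidable_const)
  then show ?thesis by (simp add: turing_le_iff_decidable stack_set_def)
qed

lemma decidable_confirmed:
  assumes "computable A f" "computable A g" "computable A h"
  shows "decidable A (\<lambda>x. confirmed (list_decode (f x)) (g x) (h x))"
  unfolding confirmed_def
  by (intro computable_intros decidable_converges[OF empty_turing_le] assms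
      computable_comp[OF assms(2)] computable_comp[OF assms(3)])

lemma decidable_verified:
  assumes "computable A f" "computable A g" "computable A h"
  shows "decidable A (\<lambda>x. verified (list_decode (f x)) (g x) (h x))"
  unfolding verified_def
  by (intro computable_intros decidable_converges[OF empty_turing_le] decidable_confirmed assms
      computable_comp[OF assms(1)] computable_comp[OF assms(2)] computable_comp[OF assms(3)])

section \<open>Decoding an oracle\<close>

definition end_extends :: "nat set \<Rightarrow> nat set \<Rightarrow> bool" where
  "end_extends E D \<longleftrightarrow> D \<subseteq> E \<and> (\<forall>x\<in>E - D. \<forall>d\<in>D. d < x)"

lemma end_extends_refl: "end_extends D D"
  by (simp add: end_extends_def)

lemma end_extends_trans: "end_extends F E \<Longrightarrow> end_extends E D \<Longrightarrow> end_extends F D"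
  unfolding end_extends_def by blast

lemma end_extends_chain:
  assumes "\<And>m. end_extends (E (Suc m)) (E m)" "m \<le> k"
  shows "end_extends (E k) (E m)"
  using \<open>m \<le> k\<close> assms(1) end_extends_refl end_extends_trans
  by (induction k rule: dec_induct) blast+

lemma not_mem_end_extends_chain_Union_iff:
  assumes chain: "\<And>m. end_extends (E (Suc m)) (E m)" and "infinite (\<Union>m. E m)"
  shows "x \<notin> (\<Union>m. E m) \<longleftrightarrow> (\<exists>m. x \<notin> E m \<and> (\<exists>d\<in>E m. x < d))"
proof
  assume "x \<notin> (\<Union>m. E m)"
  moreover obtain d where "d \<in> (\<Union>m. E m)" "x < d"
    using \<open>infinite (\<Union>m. E m)\<close> by (meson infinite_nat_iff_unbounded)
  ultimately show "\<exists>m. x \<notin> E m \<and> (\<exists>d\<in>E m. x < d)" by auto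
next
  assume "\<exists>m. x \<notin> E m \<and> (\<exists>d\<in>E m. x < d)"
  then obtain m d where passed: "x \<notin> E m" "d \<in> E m" "x < d" by blast
  have "x \<notin> E k" for k
  proof (cases "k \<le> m")
    case True
    then show ?thesis using end_extends_chain[of E, OF chain] passed(1)
      by (auto simp: end_extends_def)
  next
    case False
    then have "end_extends (E k) (E m)" using end_extends_chain[of E, OF chain] by simp
    then show ?thesis using passed unfolding end_extends_def by (meson DiffI less_asym)
  qed
  then show "x \<notin> (\<Union>m. E m)" by blast
qed

lemma end_extends_chain_Union_turing_le:
  fixes E :: "nat \<Rightarrow> nat set"
  assumes finite: "\<And>m. finite (E m)" and chain: "\<And>m. end_extends (E (Suc m)) (E m)"
    and computable: "computable A (\<lambda>m. set_encode (E m))"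
  shows "(\<Union>m. E m) \<le>\<^sub>T A"
proof (cases "finite (\<Union>m. E m)")
  case True
  have "decidable A (\<lambda>x. x \<in> set_decode (set_encode (\<Union>m. E m)))" by (intro computable_intros)
  then show ?thesis using True by (simp add: turing_le_iff_decidable)
next
  case False
  let ?E = "\<lambda>m. set_decode (set_encode (E m))"
  note code = computable_comp[OF computable]
  show ?thesis
    unfolding turing_le_iff_decidable
  proof (rule decidable_if_semidecidable)
    show "decidable2 A (\<lambda>x m. x \<in> ?E m)" by (intro computable_intros code)
    show "decidable2 A (\<lambda>x m. x \<notin> ?E m \<and> (\<exists>d\<in>?E m. x < d))" by (intro computable_intros code)
    show "x \<in> (\<Union>m. E m) \<longleftrightarrow> (\<exists>m. x \<in> ?E m)" for x by (simp add: finite)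
    show "x \<notin> (\<Union>m. E m) \<longleftrightarrow> (\<exists>m. x \<notin> ?E m \<and> (\<exists>d\<in>?E m. x < d))" for x
      using not_mem_end_extends_chain_Union_iff[OF chain False] by (simp add: finite)
  qed
qed

text \<open>
  While the elements of the oracle are read in increasing order, a state holds the last two of them,
  the number of bits 0 since the last bit 1, the part of the generated set enumerated so far, and a
  stack of programs. While a program stays on the stack, only members of its set are enumerated.
\<close>

datatype state =
  State (penultimate: nat) (latest: nat) (zeros: nat) (part: "nat set") (stack: "nat list")

definition encode_state :: "state \<Rightarrow> nat" where
  "encode_state \<sigma> =
     \<langle>penultimate \<sigma>, \<langle>latest \<sigma>, \<langle>zeros \<sigma>, \<langle>set_encode (part \<sigma>), list_encode (stack \<sigma>)\<rangle>\<rangle>\<rangle>\<rangle>"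

definition decode_state :: "nat \<Rightarrow> state" where
  "decode_state k = State (proj1 k) (proj1 (proj2 k)) (proj1 (proj2 (proj2 k)))
     (set_decode (proj1 (proj2 (proj2 (proj2 k))))) (list_decode (proj2 (proj2 (proj2 (proj2 k)))))"

lemma decode_encode_state: "finite (part \<sigma>) \<Longrightarrow> decode_state (encode_state \<sigma>) = \<sigma>"
  by (cases \<sigma>) (simp add: decode_state_def encode_state_def)

lemma computable_state_sel:
  assumes "computable A (\<lambda>x. encode_state (\<sigma> x))"
  shows "computable A (\<lambda>x. penultimate (\<sigma> x))" "computable A (\<lambda>x. latest (\<sigma> x))"
    "computable A (\<lambda>x. set_encode (part (\<sigma> x)))" "computable A (\<lambda>x. list_encode (stack (\<sigma> x)))"
  using computable_proj1[OF assms] computable_proj1[OF computable_proj2[OF assms]]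
    computable_proj1[OF computable_proj2[OF computable_proj2[OF computable_proj2[OF assms]]]]
    computable_proj2[OF computable_proj2[OF computable_proj2[OF computable_proj2[OF assms]]]]
  by (simp_all add: encode_state_def)

definition acceptable :: "nat set \<Rightarrow> nat list \<Rightarrow> nat set \<Rightarrow> nat \<Rightarrow> bool" where
  "acceptable D s E t \<longleftrightarrow> end_extends E D \<and> (\<forall>x\<in>E - D. confirmed s x t)"

definition surviving_stack :: "nat \<Rightarrow> state \<Rightarrow> nat list" where
  "surviving_stack r \<sigma> = (if verified (stack \<sigma>) (latest \<sigma>) r then stack \<sigma> else tl (stack \<sigma>))"

definition coded_condition :: "state \<Rightarrow> condition" where
  "coded_condition \<sigma> = (part \<sigma>, {y \<in> stack_set (stack \<sigma>). \<forall>d\<in>part \<sigma>. d < y})"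

definition builds_on :: "state \<Rightarrow> state \<Rightarrow> bool" where
  "builds_on \<tau> \<sigma> \<longleftrightarrow> (\<exists>l. stack \<tau> = l @ stack \<sigma>) \<and> end_extends (part \<tau>) (part \<sigma>) \<and>
     part \<tau> - part \<sigma> \<subseteq> stack_set (stack \<sigma>)"

lemma ideal_condition_coded_condition:
  assumes "genuine (stack \<sigma>)" "finite (part \<sigma>)"
  shows "ideal_condition COMP (coded_condition \<sigma>)"
proof -
  let ?S = "stack_set (stack \<sigma>)" and ?T = "{y \<in> stack_set (stack \<sigma>). \<forall>d\<in>part \<sigma>. d < y}"
  have "decidable {} (\<lambda>y. y \<in> ?S \<and> (\<forall>d\<in>set_decode (set_encode (part \<sigma>)). d < y))"
    by (intro computable_intros decidable_mem[OF genuine_computable[OF assms(1)]])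
  then have "?T \<in> COMP" using assms(2) by (simp add: COMP_def turing_le_iff_decidable)
  moreover have "infinite ?T"
  proof
    assume "finite ?T"
    then have "finite (?T \<union> (\<Union>d\<in>part \<sigma>. {..d}))" using assms(2) by simp
    moreover have "?S \<subseteq> ?T \<union> (\<Union>d\<in>part \<sigma>. {..d})" by (auto simp: not_less)
    ultimately have "finite ?S" by (rule rev_finite_subset)
    then show False using assms(1) by (simp add: genuine_def)
  qed
  ultimately show ?thesis
    using assms(2) by (auto simp: ideal_condition_def mathias_condition_def coded_condition_def)
qed

lemma decidable_acceptable:
  assumes "computable A f" "computable A g" "computable A h" "computable A k"
  shows "decidable A
    (\<lambda>x. acceptable (set_decode (f x)) (list_decode (g x)) (set_decode (h x)) (k x))"
proof -
  have "acceptable (set_decode d) s (set_decode e) t \<longleftrightarrow> (\<forall>x\<in>set_decode d. x \<in> set_decode e) \<and>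
      (\<forall>x\<in>set_decode e. x \<notin> set_decode d \<longrightarrow> (\<forall>z\<in>set_decode d. z < x) \<and> confirmed s x t)" for d e s t
    unfolding acceptable_def end_extends_def by blast
  then show ?thesis
    by (simp only:) (intro computable_intros decidable_confirmed assms computable_comp[OF assms(1)]
      computable_comp[OF assms(2)] computable_comp[OF assms(3)] computable_comp[OF assms(4)])
qed

lemma Least_reservoir: "mathias_condition p \<Longrightarrow> (LEAST s. s \<in> snd p) \<in> snd p"
  by (rule LeastI_ex) (auto simp: mathias_condition_def ex_in_conv)

context
  fixes R :: "nat \<Rightarrow> nat \<Rightarrow> bool"
begin

text \<open>
  Three consecutive elements \<open>p < q < r\<close> of the oracle code the bit 1 if \<open>r\<close> reveals that \<open>q\<close> does
  not bound the settling times below \<open>p\<close>; without the delay the bit would not be decidable.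
\<close>

definition coded_bit :: "nat \<Rightarrow> nat \<Rightarrow> nat \<Rightarrow> bool" where
  "coded_bit p q r \<longleftrightarrow> (\<exists>u<p. (\<exists>t<r. R u t) \<and> \<not> (\<exists>t<q. R u t))"

lemma not_coded_bit_if_settled: "settled_by R p q \<Longrightarrow> \<not> coded_bit p q r"
  unfolding coded_bit_def settled_by_def projection_def by blast

lemma eventually_coded_bit: "\<not> settled_by R p q \<Longrightarrow> \<exists>t. \<forall>r\<ge>t. coded_bit p q r"
proof -
  assume "\<not> settled_by R p q"
  then obtain u t where "u < p" "R u t" "\<not> (\<exists>t<q. R u t)"
    unfolding settled_by_def projection_def by blast
  then have "coded_bit p q r" if "Suc t \<le> r" for r
    using that unfolding coded_bit_def by (meson Suc_le_lessD)
  then show ?thesis by blast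
qed

text \<open>
  The counter of bits 0 proposes its first component, so every pair of a finite set and a program is
  proposed by arbitrarily large counters and can be reached without pushing anything else before it.
\<close>

definition update :: "nat \<Rightarrow> state \<Rightarrow> state" where
  "update r \<sigma> =
    (let s = surviving_stack r \<sigma>; E = set_decode (proj1 (proj1 (zeros \<sigma>)));
       e = proj2 (proj1 (zeros \<sigma>)) in
     if coded_bit (penultimate \<sigma>) (latest \<sigma>) r then
       if acceptable (part \<sigma>) s E r then State (latest \<sigma>) r 0 E (e # s)
       else State (latest \<sigma>) r 0 (part \<sigma>) s
     else State (latest \<sigma>) r (Suc (zeros \<sigma>)) (part \<sigma>) s)"

primrec run :: "nat set \<Rightarrow> nat \<Rightarrow> state" where
  "run X 0 = State 0 0 0 {} []"
| "run X (Suc m) = (if m \<in> X then update m (run X m) else run X m)"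

definition state_of :: "nat set \<Rightarrow> state" where
  "state_of D = run D (set_encode D)"

definition generated :: "nat set \<Rightarrow> nat set" where
  "generated X = (\<Union>m. part (run X m))"

lemma run_cong: "(\<And>k. k < m \<Longrightarrow> k \<in> X \<longleftrightarrow> k \<in> Y) \<Longrightarrow> run X m = run Y m"
proof (induction m)
  case (Suc m)
  have "run X m = run Y m" by (rule Suc.IH) (simp add: Suc.prems)
  then show ?case using Suc.prems[of m] by simp
qed simp

lemma run_const: "D \<subseteq> {..<m} \<Longrightarrow> run D (m + k) = run D m"
  by (induction k) auto

lemma run_eq_state_of:
  assumes "finite D" "D \<subseteq> {..<m}"
  shows "run D m = state_of D"
proof -
  have "D \<subseteq> {..<set_encode D}" using assms(1) set_decode_less[of _ "set_encode D"] by auto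
  then have "run D (set_encode D + m) = state_of D" by (simp add: run_const state_of_def)
  moreover have "run D (m + set_encode D) = run D m" by (rule run_const[OF assms(2)])
  ultimately show ?thesis by (simp add: add.commute)
qed

lemma state_of_insert:
  assumes "finite D" "\<And>d. d \<in> D \<Longrightarrow> d < y"
  shows "state_of (insert y D) = update y (state_of D)"
proof -
  have "state_of (insert y D) = run (insert y D) (Suc y)"
    using assms by (intro run_eq_state_of[symmetric]) (auto simp: less_Suc_eq)
  also have "\<dots> = update y (run (insert y D) y)" by simp
  also have "run (insert y D) y = run D y" by (rule run_cong) auto
  also have "\<dots> = state_of D" using assms by (intro run_eq_state_of) auto
  finally show ?thesis .
qed

lemma run_Least_reservoir:
  assumes satisfied: "mathias_condition p" "satisfies X p"
  shows "run X (LEAST s. s \<in> snd p) = state_of (fst p)"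
proof -
  let ?m = "LEAST s. s \<in> snd p"
  have part_below: "finite (fst p)" "fst p \<subseteq> {..<?m}"
    using satisfied(1) Least_reservoir[OF satisfied(1)] by (auto simp: mathias_condition_def)
  have "run X ?m = run (fst p) ?m"
  proof (rule run_cong)
    fix k assume "k < ?m"
    then have "k \<notin> snd p" by (rule not_less_Least)
    then show "k \<in> X \<longleftrightarrow> k \<in> fst p" using satisfied(2) by (auto simp: satisfies_def)
  qed
  then show ?thesis using run_eq_state_of[OF part_below] by simp
qed

lemma end_extends_update: "end_extends (part (update r \<sigma>)) (part \<sigma>)"
  by (simp add: update_def Let_def acceptable_def end_extends_refl)

lemma end_extends_run: "m \<le> k \<Longrightarrow> end_extends (part (run X k)) (part (run X m))"
  by (rule end_extends_chain) (simp_all add: end_extends_update end_extends_refl)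

lemma finite_part_run: "finite (part (run X m))"
  by (induction m) (simp_all add: update_def Let_def)

lemma finite_part_state_of: "finite (part (state_of D))"
  by (simp add: state_of_def finite_part_run)

lemma builds_on_update:
  assumes builds_on: "builds_on \<tau> \<sigma>" and verified: "verified (stack \<sigma>) (latest \<tau>) r"
  shows "builds_on (update r \<tau>) \<sigma>"
proof -
  obtain l where stack_eq: "stack \<tau> = l @ stack \<sigma>" using builds_on by (auto simp: builds_on_def)
  have "\<exists>l. surviving_stack r \<tau> = l @ stack \<sigma>"
    using stack_eq verified by (cases l) (auto simp: surviving_stack_def)
  then obtain l' where surviving_eq: "surviving_stack r \<tau> = l' @ stack \<sigma>" ..
  have "\<exists>l. stack (update r \<tau>) = l @ stack \<sigma>"
    using surviving_eq by (auto simp: update_def Let_def)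
  moreover have "end_extends (part (update r \<tau>)) (part \<sigma>)"
    using end_extends_update end_extends_trans builds_on unfolding builds_on_def by blast
  moreover have "confirmed (stack \<sigma>) x r" if "x \<in> part (update r \<tau>) - part \<tau>" for x
    using that surviving_eq
    by (auto simp: update_def Let_def acceptable_def confirmed_def split: if_splits)
  then have "part (update r \<tau>) - part \<tau> \<subseteq> stack_set (stack \<sigma>)" using mem_stack_set_iff by blast
  ultimately show ?thesis using builds_on unfolding builds_on_def by blast
qed

definition stable_at :: "state \<Rightarrow> nat \<Rightarrow> nat \<Rightarrow> bool" where
  "stable_at \<sigma> x y \<longleftrightarrow> verified (stack \<sigma>) (latest \<sigma>) y \<and>
     \<not> coded_bit (penultimate \<sigma>) (latest \<sigma>) y \<and> (x < y \<longrightarrow> verified (stack \<sigma>) x y)"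

definition stable :: "condition \<Rightarrow> bool" where
  "stable p \<longleftrightarrow> (\<forall>x\<in>snd p. \<forall>y\<in>snd p. x \<le> y \<longrightarrow> stable_at (state_of (fst p)) x y)"

lemma stable_run:
  assumes satisfied: "mathias_condition p" "stable p" "satisfies X p" and "(LEAST s. s \<in> snd p) \<le> m"
  shows "builds_on (run X m) (state_of (fst p)) \<and>
    (latest (run X m) = latest (state_of (fst p)) \<or>
     latest (run X m) \<in> snd p \<and> latest (run X m) < m)"
  using \<open>(LEAST s. s \<in> snd p) \<le> m\<close>
proof (induction m rule: dec_induct)
  case base
  show ?case by (simp add: run_Least_reservoir[OF satisfied(1,3)] builds_on_def end_extends_refl)
next
  case (step m)
  show ?case
  proof (cases "m \<in> X")
    case False
    then show ?thesis using step.IH by auto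
  next
    case True
    have "m \<notin> fst p"
      using satisfied(1) Least_reservoir[OF satisfied(1)] step.hyps(1)
      by (fastforce simp: mathias_condition_def)
    then have mem_reservoir: "m \<in> snd p" using True satisfied(3) by (auto simp: satisfies_def)
    then have "verified (stack (state_of (fst p))) (latest (run X m)) m"
      using step.IH satisfied(2) unfolding stable_def stable_at_def
      by (metis less_imp_le order_refl)
    then have "builds_on (update m (run X m)) (state_of (fst p))"
      using step.IH builds_on_update by blast
    moreover have "latest (update m (run X m)) = m" by (simp add: update_def Let_def)
    ultimately show ?thesis using True mem_reservoir by simp
  qed
qed

lemma satisfies_generated:
  assumes satisfied: "mathias_condition p" "stable p" "satisfies X p"
  shows "satisfies (generated X) (coded_condition (state_of (fst p)))"
proof -
  let ?m = "LEAST s. s \<in> snd p" and ?\<sigma> = "state_of (fst p)"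
  have run_Least: "run X ?m = ?\<sigma>" by (rule run_Least_reservoir[OF satisfied(1,3)])
  have "part (run X k) \<subseteq> part ?\<sigma> \<union> snd (coded_condition ?\<sigma>)" for k
  proof (cases "?m \<le> k")
    case True
    then have "builds_on (run X k) ?\<sigma>" using stable_run[OF satisfied] by blast
    then show ?thesis by (auto simp: builds_on_def end_extends_def coded_condition_def)
  next
    case False
    then have "end_extends (part ?\<sigma>) (part (run X k))"
      using end_extends_run[of k ?m X] run_Least by simp
    then show ?thesis by (auto simp: end_extends_def)
  qed
  moreover have "part (run X ?m) \<subseteq> generated X" by (auto simp: generated_def)
  ultimately show ?thesis unfolding run_Least
    by (auto simp: satisfies_def coded_condition_def generated_def)
qed

end

section \<open>Coding computable conditions into a generic set\<close>

locale generic_coding = generic_set +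
  fixes B :: "nat set" and R :: "nat \<Rightarrow> nat \<Rightarrow> bool"
  assumes B_mem: "B \<in> I" and B_le: "B \<le>\<^sub>T G" and R: "decidable2 B R"
    and proj_notin: "projection R \<notin> I"
begin

abbreviation state :: "condition \<Rightarrow> state" where
  "state p \<equiv> state_of R (fst p)"

definition settled :: "condition \<Rightarrow> bool" where
  "settled p \<longleftrightarrow> settled_by R (penultimate (state p)) (latest (state p))"

lemma decidable_coded_bit: "B \<le>\<^sub>T C \<Longrightarrow> decidable3 C (coded_bit R)"
  unfolding coded_bit_def by (intro computable_intros decidable2_comp[OF decidable_mono[OF _ R]])

lemma computable_update:
  assumes "B \<le>\<^sub>T C" "computable C f" "computable C g"
  shows "computable C (\<lambda>x. encode_state (update R (f x) (decode_state (g x))))"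
proof -
  define s where "s r k = (let s = proj2 (proj2 (proj2 (proj2 k))) in
    if verified (list_decode s) (proj1 (proj2 k)) r then s else proj2 (s - 1))" for r k
  have computable_s: "computable2 C s"
    unfolding s_def Let_def by (intro computable_intros decidable_verified)
  have "surviving_stack r (decode_state k) = list_decode (s r k)" for r k
    using list_decode_tl by (simp add: surviving_stack_def decode_state_def s_def Let_def)
  then have "encode_state (update R r (decode_state k)) =
    (let p = proj1 k; q = proj1 (proj2 k); c = proj1 (proj2 (proj2 k));
       D = proj1 (proj2 (proj2 (proj2 k)));
       E = proj1 (proj1 c); e = proj2 (proj1 c) in
     if coded_bit R p q r then
       if acceptable (set_decode D) (list_decode (s r k)) (set_decode E) r
       then \<langle>q, \<langle>r, \<langle>0, \<langle>E, Suc \<langle>e, s r k\<rangle>\<rangle>\<rangle>\<rangle>\<rangle> else \<langle>q, \<langle>r, \<langle>0, \<langle>D, s r k\<rangle>\<rangle>\<rangle>\<rangle>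
     else \<langle>q, \<langle>r, \<langle>Suc c, \<langle>D, s r k\<rangle>\<rangle>\<rangle>\<rangle>)" for r k
    unfolding update_def by (simp add: encode_state_def decode_state_def Let_def)
  then have "computable2 C (\<lambda>r k. encode_state (update R r (decode_state k)))"
    by (simp only: Let_def) (intro computable_intros decidable_acceptable
      decidable3_comp[OF decidable_coded_bit[OF assms(1)]]
      computable2_comp[OF computable_s])
  then show ?thesis using assms(2,3) by (rule computable2_comp)
qed

lemma computable_run:
  assumes "B \<le>\<^sub>T C" "decidable2 C (\<lambda>x k. k \<in> X x)" "computable C m"
  shows "computable C (\<lambda>x. encode_state (run R (X x) (m x)))"
proof (rule computable_primrec[where F = "\<lambda>x m. encode_state (run R (X x) m)" and n = m])
  show "encode_state (run R (X x) (Suc k)) = (if k \<in> X x then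
      encode_state (update R k (decode_state (encode_state (run R (X x) k))))
      else encode_state (run R (X x) k))" for x k
    by (simp add: decode_encode_state finite_part_run)
  show "computable3 C (\<lambda>x k s. if k \<in> X x then encode_state (update R k (decode_state s)) else s)"
    by (intro computable_intros computable_update assms(1) decidable2_comp[OF assms(2)])
qed (simp_all add: computable_const assms(3))

lemma computable_state_of: "B \<le>\<^sub>T C \<Longrightarrow> computable C (\<lambda>h. encode_state (state_of R (set_decode h)))"
  unfolding state_of_def set_decode_inverse by (intro computable_run computable_intros)

lemma decidable_stable_at:
  assumes "B \<le>\<^sub>T C"
  shows "decidable3 C (\<lambda>h. stable_at R (state_of R (set_decode h)))"
proof -
  note state = computable_comp[OF computable_state_of[OF assms] computable_proj1_id]
  note sel = computable_state_sel[OF state]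
  have "decidable C (\<lambda>p. let \<sigma> = state_of R (set_decode (proj1 p));
      s = list_decode (list_encode (stack \<sigma>));
      x = proj1 (proj2 p); y = proj2 (proj2 p) in
      verified s (latest \<sigma>) y \<and> \<not> coded_bit R (penultimate \<sigma>) (latest \<sigma>) y \<and>
      (x < y \<longrightarrow> verified s x y))"
    unfolding Let_def
    by (intro computable_intros decidable_verified
        decidable3_comp[OF decidable_coded_bit[OF assms]] sel)
  then show ?thesis by (simp add: stable_at_def Let_def)
qed

lemma generated_turing_le: "generated R G \<le>\<^sub>T G"
  unfolding generated_def
proof (rule end_extends_chain_Union_turing_le)
  show "computable G (\<lambda>m. set_encode (part (run R G m)))"
    by (intro computable_state_sel computable_run B_le computable_intros decidable_mem
        turing_le_refl)
  show "end_extends (part (run R G (Suc m))) (part (run R G m))" for m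
    by (rule end_extends_run) simp
qed (rule finite_part_run)

lemma state_adjoin:
  "ideal_condition I p \<Longrightarrow> y \<in> snd p \<Longrightarrow> state (adjoin y p) = update R y (state p)"
  unfolding adjoin_def fst_conv by (intro state_of_insert ideal_conditionD)

lemma obtain_settled_adjoin:
  assumes cond: "ideal_condition I p" and settled: "settled p"
  obtains y where "y \<in> snd p" "m \<le> y" "adjoin y p \<preceq> p" "settled (adjoin y p)"
    "state (adjoin y p) = State (latest (state p)) y (Suc (zeros (state p))) (part (state p))
       (surviving_stack y (state p))"
proof -
  obtain t where settled_after_t: "\<And>y. t \<le> y \<Longrightarrow> settled_by R (latest (state p)) y"
    using eventually_settled_by by blast
  obtain y where y_large: "y \<in> snd p" "m + t \<le> y" using ideal_condition_unbounded[OF cond] by blast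
  have "state (adjoin y p) = State (latest (state p)) y (Suc (zeros (state p))) (part (state p))
      (surviving_stack y (state p))"
    using settled unfolding state_adjoin[OF cond y_large(1)]
    by (simp add: settled_def update_def Let_def not_coded_bit_if_settled)
  moreover from this have "settled (adjoin y p)" using settled_after_t y_large(2)
    by (simp add: settled_def)
  ultimately show ?thesis using that y_large adjoin_extends[OF cond] by simp
qed

lemma stable_settled:
  assumes cond: "ideal_condition I p" and stable: "stable R p"
  shows "settled p"
proof (rule ccontr)
  assume "\<not> settled p"
  then obtain t where "\<And>r. t \<le> r \<Longrightarrow> coded_bit R (penultimate (state p)) (latest (state p)) r"
    using eventually_coded_bit unfolding settled_def by blast
  moreover obtain y where "y \<in> snd p" "t \<le> y" using ideal_condition_unbounded[OF cond] by blast
  ultimately show False using stable unfolding stable_def stable_at_def by blast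
qed

lemma stable_genuine:
  assumes cond: "ideal_condition I p" and stable: "stable R p"
  shows "genuine (stack (state p))"
proof (rule genuine_if_verified)
  fix m
  obtain x where x_large: "x \<in> snd p" "m \<le> x" using ideal_condition_unbounded[OF cond] by blast
  obtain y where y_large: "y \<in> snd p" "Suc x \<le> y" using ideal_condition_unbounded[OF cond] by blast
  have "verified (stack (state p)) x y" using stable x_large y_large
    by (simp add: stable_def stable_at_def)
  then show "\<exists>t. verified (stack (state p)) m t" using verified_mono x_large(2) by blast
qed

lemma stable_subset: "stable R p \<Longrightarrow> fst q = fst p \<Longrightarrow> snd q \<subseteq> snd p \<Longrightarrow> stable R q"
  unfolding stable_def by (simp add: subset_iff)

lemma ex_stable_same_part:
  assumes cond: "ideal_condition I p" and "settled p" and genuine: "genuine (stack (state p))"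
  shows "\<exists>q. q \<preceq> p \<and> stable R q \<and> fst q = fst p"
proof -
  let ?s = "stack (state p)"
  obtain S' where homogeneous: "S' \<subseteq> snd p" "infinite S'" "S' \<in> I"
    "\<forall>y\<in>S'. latest (state p) < y \<and> verified ?s (latest (state p)) y"
    "\<forall>x\<in>S'. \<forall>y\<in>S'. x < y \<longrightarrow> verified ?s x y"
  proof (rule obtain_homogeneous_subset[OF ideal_conditionD(3,2)[OF cond]])
    show "{} \<in> I" by (rule computable_mem[OF turing_le_refl])
    have "decidable2 {} (\<lambda>x y. verified (list_decode (list_encode ?s)) x y)"
      by (intro decidable_verified computable_intros)
    then show "decidable2 {} (verified ?s)" by simp
    show "verified ?s x' y" if "verified ?s x y" "x' \<le> x" for x x' y
      using that by (rule verified_mono) simp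
    show "\<exists>t. \<forall>y\<ge>t. verified ?s x y" for x
      using verified_if_genuine[OF genuine] verified_mono by blast
  qed blast
  then have "(fst p, S') \<preceq> p" by (intro ideal_extends_subset cond)
  moreover have "stable R (fst p, S')"
    using homogeneous(4,5) not_coded_bit_if_settled \<open>settled p\<close>
    by (simp add: stable_def stable_at_def settled_def)
  ultimately show ?thesis by (intro exI[of _ "(fst p, S')"]) simp
qed

text \<open>A stack that is not genuine loses its top after two large elements coding the bit 0.\<close>

lemma ex_settled_shorter_stack:
  assumes cond: "ideal_condition I p" and settled: "settled p"
    and not_genuine: "\<not> genuine (stack (state p))"
  shows "\<exists>q. q \<preceq> p \<and> settled q \<and> length (stack (state q)) < length (stack (state p))"
proof -
  let ?s = "stack (state p)"
  obtain x where unverified: "\<And>t. \<not> verified ?s x t" using not_genuine genuine_if_verified by blast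
  have "?s \<noteq> []"
  proof
    assume "?s = []"
    then have "verified ?s x (Suc x)" by (auto simp: verified_def confirmed_def)
    then show False using unverified by blast
  qed
  obtain y where y_extends: "y \<in> snd p" "x \<le> y" "adjoin y p \<preceq> p" "settled (adjoin y p)"
    and state_y: "latest (state (adjoin y p)) = y"
      "stack (state (adjoin y p)) = surviving_stack y (state p)"
    using obtain_settled_adjoin[OF cond settled, of x] by (metis state.sel(2,5))
  obtain z where z_extends: "adjoin z (adjoin y p) \<preceq> adjoin y p" "settled (adjoin z (adjoin y p))"
    and state_z: "stack (state (adjoin z (adjoin y p))) = surviving_stack z (state (adjoin y p))"
    using obtain_settled_adjoin[OF ideal_extends_imp_condition[OF y_extends(3)] y_extends(4)]
    by (metis state.sel(5))
  have "length (surviving_stack z (state (adjoin y p))) < length ?s"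
  proof (cases "surviving_stack y (state p) = ?s")
    case True
    have "\<not> verified ?s y z" using unverified verified_mono[OF _ y_extends(2) order_refl] by blast
    then show ?thesis using True \<open>?s \<noteq> []\<close> by (simp add: surviving_stack_def[of z] state_y)
  next
    case False
    then have "length (surviving_stack y (state p)) < length ?s"
      using \<open>?s \<noteq> []\<close> by (simp add: surviving_stack_def split: if_splits)
    moreover have "length (surviving_stack z (state (adjoin y p)))
        \<le> length (surviving_stack y (state p))"
      by (simp add: surviving_stack_def[of z] state_y)
    ultimately show ?thesis by simp
  qed
  moreover have "adjoin z (adjoin y p) \<preceq> p" using z_extends(1) y_extends(3)
    by (rule ideal_extends_trans)
  ultimately show ?thesis using z_extends(2) unfolding state_z[symmetric] by blast
qed

lemma ex_stable_if_settled:
  assumes "ideal_condition I p" "settled p"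
  shows "\<exists>q. q \<preceq> p \<and> stable R q"
  using assms
proof (induction "length (stack (state p))" arbitrary: p rule: less_induct)
  case less
  show ?case
  proof (cases "genuine (stack (state p))")
    case True
    then show ?thesis using ex_stable_same_part less.prems by blast
  next
    case False
    then obtain q
      where shorter: "q \<preceq> p" "settled q" "length (stack (state q)) < length (stack (state p))"
      using ex_settled_shorter_stack less.prems by blast
    then show ?thesis using less.hyps[of q] ideal_extends_trans unfolding ideal_extends_def by meson
  qed
qed

lemma stable_dense:
  assumes cond: "ideal_condition I p"
  shows "\<exists>q. q \<preceq> p \<and> stable R q \<and> (\<exists>d\<in>fst q. m \<le> d)"
proof -
  obtain y where y_large: "y \<in> snd p" "m \<le> y" using ideal_condition_unbounded[OF cond] by blast
  obtain t where settled_after_t: "\<And>z. t \<le> z \<Longrightarrow> settled_by R y z"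
    using eventually_settled_by by blast
  note y_extends = adjoin_extends[OF cond y_large(1)]
  note y_condition = ideal_extends_imp_condition[OF y_extends]
  obtain z where z_large: "z \<in> snd (adjoin y p)" "t \<le> z"
    using ideal_condition_unbounded[OF y_condition] by blast
  note z_extends = adjoin_extends[OF y_condition z_large(1)]
  have "penultimate (state (adjoin z (adjoin y p))) = y"
    "latest (state (adjoin z (adjoin y p))) = z"
    by (simp_all add: state_adjoin[OF y_condition z_large(1)] state_adjoin[OF cond y_large(1)]
        update_def Let_def)
  then have "settled (adjoin z (adjoin y p))" using settled_after_t z_large(2)
    by (simp add: settled_def)
  then obtain q where stable_q: "q \<preceq> adjoin z (adjoin y p)" "stable R q"
    using ex_stable_if_settled[OF ideal_extends_imp_condition[OF z_extends]] by blast
  have "y \<in> fst q" using stable_q(1) by (auto simp: ideal_extends_def extends_def adjoin_def)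
  moreover have "q \<preceq> p" using stable_q(1) z_extends y_extends ideal_extends_trans by blast
  ultimately show ?thesis using stable_q(2) y_large(2) by blast
qed

lemma state_adjoin_stable:
  assumes "ideal_condition I p" "stable R p" "y \<in> snd p"
  shows "state (adjoin y p) =
    State (latest (state p)) y (Suc (zeros (state p))) (part (state p)) (stack (state p))"
proof -
  have "stable_at R (state p) y y" using assms(2,3) by (simp add: stable_def)
  then show ?thesis
    unfolding state_adjoin[OF assms(1,3)]
    by (simp add: update_def surviving_stack_def stable_at_def Let_def)
qed

lemma ex_stable_zeros:
  assumes cond: "ideal_condition I p" and stable: "stable R p" and "zeros (state p) \<le> c"
  shows "\<exists>q. q \<preceq> p \<and> stable R q \<and> zeros (state q) = c \<and>
    part (state q) = part (state p) \<and> stack (state q) = stack (state p)"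
  using \<open>zeros (state p) \<le> c\<close>
proof (induction c rule: dec_induct)
  case base
  show ?case using ideal_extends_refl[OF cond] stable by blast
next
  case (step c)
  then obtain q where stable_q: "q \<preceq> p" "stable R q" "zeros (state q) = c"
    "part (state q) = part (state p)" "stack (state q) = stack (state p)" by blast
  note cond_q = ideal_extends_imp_condition[OF stable_q(1)]
  obtain y where y: "y \<in> snd q" "adjoin y q \<preceq> q" "settled (adjoin y q)"
    using obtain_settled_adjoin[OF cond_q stable_settled[OF cond_q stable_q(2)]] by blast
  note state_y = state_adjoin_stable[OF cond_q stable_q(2) y(1)]
  have "stable R (adjoin y q)"
    using stable_q(2) y(1,3) unfolding stable_def
    by (auto simp: stable_at_def state_y settled_def not_coded_bit_if_settled adjoin_sel(2))
  moreover have "adjoin y q \<preceq> p" using y(2) stable_q(1) by (rule ideal_extends_trans)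
  ultimately show ?case using stable_q(3-5) by (intro exI[of _ "adjoin y q"]) (simp add: state_y)
qed

lemma ex_unsettled_pair:
  assumes reservoir: "S \<in> I" "infinite S"
  shows "\<exists>x\<in>S. \<exists>y\<in>S. x < y \<and> \<not> settled_by R x y"
proof (rule ccontr)
  assume "\<not> ?thesis"
  then have "projection R \<le>\<^sub>T S \<oplus>\<^sub>T B"
    using reservoir(2) decidable_mono[OF turing_le_join2 R]
    by (intro projection_turing_le_if_settled[of _ R S] turing_le_join1) auto
  then show False using mem_if_turing_le join_mem[OF reservoir(1) B_mem] proj_notin by blast
qed

lemma ex_pending_bit:
  assumes cond: "ideal_condition I p" and stable: "stable R p"
  obtains q x y where "q \<preceq> p" "\<not> settled_by R x y"
    "state q = State x y (Suc (Suc (zeros (state p)))) (part (state p)) (stack (state p))"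
    "\<And>z. z \<in> snd q \<Longrightarrow> verified (stack (state p)) y z"
proof -
  let ?\<sigma> = "state p"
  obtain t where settled_after_t: "\<And>x. t \<le> x \<Longrightarrow> settled_by R (latest ?\<sigma>) x"
    using eventually_settled_by by blast
  obtain x y where x_large: "x \<in> snd p" "t \<le> x" and y_large: "y \<in> snd p" "x < y"
    and unsettled: "\<not> settled_by R x y"
    using ex_unsettled_pair[OF reservoir_tail(2,1)[OF cond, of t]] by auto
  note x_extends = adjoin_extends[OF cond x_large(1)]
  note x_condition = ideal_extends_imp_condition[OF x_extends]
  have y_reservoir: "y \<in> snd (adjoin x p)" using y_large by (simp add: adjoin_def)
  have verified: "verified (stack ?\<sigma>) u v" if "u \<in> snd p" "v \<in> snd p" "u < v" for u v
    using stable that by (auto simp: stable_def stable_at_def)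
  note state_x = state_adjoin_stable[OF cond stable x_large(1)]
  have "state (adjoin y (adjoin x p)) = State x y (Suc (Suc (zeros ?\<sigma>))) (part ?\<sigma>) (stack ?\<sigma>)"
    using verified[OF x_large(1) y_large] settled_after_t[OF x_large(2)]
    unfolding state_adjoin[OF x_condition y_reservoir]
    by (simp add: update_def surviving_stack_def state_x not_coded_bit_if_settled Let_def)
  moreover have "verified (stack ?\<sigma>) y z" if "z \<in> snd (adjoin y (adjoin x p))" for z
    using that y_large(1) verified by (auto simp: adjoin_def)
  moreover have "adjoin y (adjoin x p) \<preceq> p"
    using adjoin_extends[OF x_condition y_reservoir] x_extends by (rule ideal_extends_trans)
  ultimately show ?thesis using that unsettled by blast
qed

lemma ex_settled_push:
  assumes cond: "ideal_condition I p" and state: "state p = State x y \<langle>\<langle>set_encode E, e\<rangle>, c\<rangle> D s"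
    and bit: "\<not> settled_by R x y" and verified: "\<And>z. z \<in> snd p \<Longrightarrow> verified s y z"
    and end_extension: "finite E" "end_extends E D" "E - D \<subseteq> stack_set s"
  shows "\<exists>q. q \<preceq> p \<and> settled q \<and> part (state q) = E \<and> stack (state q) = e # s"
proof -
  obtain t1 where bit_time: "\<And>z. t1 \<le> z \<Longrightarrow> coded_bit R x y z"
    using eventually_coded_bit[OF bit] by blast
  obtain t2 where settling_time: "\<And>z. t2 \<le> z \<Longrightarrow> settled_by R y z"
    using eventually_settled_by by blast
  have "\<exists>t. \<forall>x\<in>E - D. confirmed s x t"
    using end_extension(1,3) mem_stack_set_iff by (intro uniform_bound) (auto elim: confirmed_mono)
  then obtain t3 where confirmation_time: "\<And>x. x \<in> E - D \<Longrightarrow> confirmed s x t3" by blast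
  obtain z where z_large: "z \<in> snd p" "t1 + t2 + t3 \<le> z"
    using ideal_condition_unbounded[OF cond] by blast
  have "acceptable D s E z"
    using end_extension(2) confirmed_mono[OF confirmation_time] z_large(2)
    by (simp add: acceptable_def)
  moreover have "surviving_stack z (state p) = s"
    using verified[OF z_large(1)] by (simp add: surviving_stack_def state)
  ultimately have "state (adjoin z p) = State y z 0 E (e # s)"
    using bit_time[of z] z_large(2) end_extension(1) unfolding state_adjoin[OF cond z_large(1)]
    by (simp add: update_def state Let_def)
  then show ?thesis
    using adjoin_extends[OF cond z_large(1)] settling_time[of z] z_large(2)
    by (intro exI[of _ "adjoin z p"]) (simp add: settled_def)
qed

lemma ex_stable_push:
  assumes cond: "ideal_condition I p" and stable: "stable R p"
    and comp: "ideal_condition COMP (E, T)" and computes_T: "computes {} e T"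
    and extends_coded: "extends (E, T) (coded_condition (state p))"
  shows "\<exists>q. q \<preceq> p \<and> stable R q \<and> part (state q) = E \<and> stack (state q) = e # stack (state p)"
proof -
  let ?D = "part (state p)" and ?s = "stack (state p)"
  have finite_E: "finite E" and infinite_T: "infinite T"
    using comp by (auto simp: ideal_condition_def mathias_condition_def)
  have end_extension: "end_extends E ?D" "E - ?D \<subseteq> stack_set ?s" and T_subset: "T \<subseteq> stack_set ?s"
    using extends_coded by (auto simp: extends_def coded_condition_def end_extends_def)
  define a where "a = \<langle>\<langle>set_encode E, e\<rangle>, zeros (state p) + 2\<rangle>"
  have "zeros (state p) + 2 \<le> a" unfolding a_def by (rule le_prod_encode_2)
  then obtain c where count: "a = Suc (Suc c)" "zeros (state p) \<le> c"
    by (metis add_2_eq_Suc' Suc_le_D Suc_le_mono)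
  obtain p_count where p_count: "p_count \<preceq> p" "stable R p_count" "zeros (state p_count) = c"
    "part (state p_count) = ?D" "stack (state p_count) = ?s"
    using ex_stable_zeros[OF cond stable count(2)] by blast
  obtain p_bit x y where p_bit: "p_bit \<preceq> p_count" and bit: "\<not> settled_by R x y"
    and state: "state p_bit = State x y a ?D ?s"
    and verified: "\<And>z. z \<in> snd p_bit \<Longrightarrow> verified ?s y z"
    using ex_pending_bit[OF ideal_extends_imp_condition[OF p_count(1)] p_count(2)]
      p_count(3-5) count(1)
    by metis
  obtain p_push
    where p_push: "p_push \<preceq> p_bit" "settled p_push" "part (state p_push) = E"
      "stack (state p_push) = e # ?s"
    using ex_settled_push[OF ideal_extends_imp_condition[OF p_bit] state[unfolded a_def] bit
        verified finite_E end_extension]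
    by blast
  have "genuine (e # ?s)" using stable_genuine[OF cond stable] computes_T infinite_T T_subset
    by (rule genuine_Cons)
  then obtain q where stable_q: "q \<preceq> p_push" "stable R q" "fst q = fst p_push"
    using ex_stable_same_part[OF ideal_extends_imp_condition[OF p_push(1)] p_push(2)] p_push(4)
    by auto
  have "q \<preceq> p" using stable_q(1) p_push(1) p_bit p_count(1) ideal_extends_trans by blast
  then show ?thesis using stable_q p_push(3,4) by (intro exI[of _ q]) simp
qed

end

context generic_coding
begin

lemma obtain_stable_satisfied:
  obtains p where "ideal_condition I p" "satisfies G p" "stable R p" "\<exists>d\<in>fst p. m \<le> d"
proof -
  define C where
    "C = homogeneous_collection I (\<lambda>D. stable_at R (state_of R D)) (\<lambda>D. \<exists>d\<in>D. m \<le> d)"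
  have C_iff: "p \<in> C \<longleftrightarrow> ideal_condition I p \<and> stable R p \<and> (\<exists>d\<in>fst p. m \<le> d)" for p
    by (auto simp: C_def homogeneous_collection_def stable_def)
  have "Sigma0_collection n I A0 A1 C"
    unfolding C_def
    by (intro Sigma0_homogeneous_collection exact n_ge_3 Sigma0_decidable computable_intros
        decidable_stable_at turing_le_exact_pair B_mem)
  moreover have "\<exists>q\<in>C. extends q p" if "ideal_condition I p" for p
    using stable_dense[OF that, of m] C_iff unfolding ideal_extends_def by blast
  ultimately obtain p where "p \<in> C" "satisfies G p" by (rule generic_meets_dense)
  then show ?thesis using that C_iff by blast
qed

definition top_index :: "state \<Rightarrow> nat" where
  "top_index \<sigma> = \<langle>set_encode (part \<sigma>), \<langle>hd (stack \<sigma>), hd (stack \<sigma>)\<rangle>\<rangle>"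

definition coding_collection :: "nat set \<Rightarrow> condition set" where
  "coding_collection W = homogeneous_collection I (\<lambda>D. stable_at R (state_of R D))
     (\<lambda>D. stack (state_of R D) \<noteq> [] \<and> top_index (state_of R D) \<in> W)"

lemma mem_coding_collection_iff:
  "p \<in> coding_collection W \<longleftrightarrow>
     ideal_condition I p \<and> stable R p \<and> stack (state p) \<noteq> [] \<and> top_index (state p) \<in> W"
  by (auto simp: coding_collection_def homogeneous_collection_def stable_def)

lemma Sigma0_coding_collection:
  assumes "W \<in> Sigma0 n {}"
  shows "Sigma0_collection n I A0 A1 (coding_collection W)"
  unfolding coding_collection_def
proof (rule Sigma0_homogeneous_collection[OF exact n_ge_3])
  let ?A = "A0 \<oplus>\<^sub>T A1" and ?\<sigma> = "\<lambda>h. state_of R (set_decode h)"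
  have B_le_pair: "B \<le>\<^sub>T ?A" by (rule turing_le_exact_pair[OF B_mem])
  then show "decidable3 ?A (\<lambda>h. stable_at R (?\<sigma> h))" by (rule decidable_stable_at)
  note sel = computable_state_sel[OF computable_state_of[OF B_le_pair]]
  let ?s = "\<lambda>h. list_encode (stack (?\<sigma> h))"
  let ?i = "\<lambda>h. \<langle>set_encode (part (?\<sigma> h)), \<langle>proj1 (?s h - 1), proj1 (?s h - 1)\<rangle>\<rangle>"
  have "{h. ?s h \<noteq> 0} \<inter> {h. ?i h \<in> W} \<in> Sigma0 n ?A"
  proof (rule Sigma0_Int)
    show "{h. ?s h \<noteq> 0} \<in> Sigma0 n ?A" by (intro Sigma0_decidable computable_intros sel)
    show "{h. ?i h \<in> W} \<in> Sigma0 n ?A"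
      by (intro Sigma0_vimage Sigma0_oracle_mono[OF empty_turing_le assms] computable_intros sel)
  qed
  also have "{h. ?s h \<noteq> 0} \<inter> {h. ?i h \<in> W} = {h. stack (?\<sigma> h) \<noteq> [] \<and> top_index (?\<sigma> h) \<in> W}"
    using list_decode_eq_Nil_iff[of "?s _"] hd_list_decode[of "?s _"]
    by (auto simp: top_index_def)
  finally show "{h. stack (?\<sigma> h) \<noteq> [] \<and> top_index (?\<sigma> h) \<in> W} \<in> Sigma0 n ?A" .
qed

lemma generated_satisfies_top:
  assumes stable_p: "ideal_condition I p" "stable R p" "satisfies G p"
    and nonempty: "stack (state p) \<noteq> []"
  shows "satisfies (generated R G) (comp_condition (top_index (state p)))"
proof -
  have "stack_set (stack (state p)) \<subseteq> accepted {} (hd (stack (state p)))"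
    using nonempty by (auto simp: stack_set_def)
  then show ?thesis
    using satisfies_generated[OF _ stable_p(2,3)] stable_p(1)
    by (fastforce simp: ideal_condition_def satisfies_def coded_condition_def indexed_condition_def
        top_index_def finite_part_state_of)
qed

lemma obtain_stable_satisfied_extension:
  assumes cond_q: "ideal_condition I q" "satisfies G q"
  obtains p where "p \<preceq> q" "stable R p" "satisfies (generated R G) (coded_condition (state p))"
proof -
  obtain p d where stable_p: "ideal_condition I p" "satisfies G p" "stable R p"
    and d_large: "d \<in> fst p" "set_encode (fst q) \<le> d"
    using obtain_stable_satisfied[of "set_encode (fst q)"] by blast
  have "fst q \<subseteq> fst p"
  proof
    fix x assume mem_x: "x \<in> fst q"
    then have "x < d"
      using set_decode_less[of x "set_encode (fst q)"] ideal_conditionD(1)[OF cond_q(1)] d_large(2)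
      by simp
    then have "x \<notin> snd p" using ideal_conditionD(4)[OF stable_p(1) d_large(1)] by (meson less_asym)
    moreover have "x \<in> G" using mem_x cond_q(2) by (auto simp: satisfies_def)
    ultimately show "x \<in> fst p" using stable_p(2) by (auto simp: satisfies_def)
  qed
  then have "(fst p, snd p \<inter> snd q) \<preceq> q"
    by (rule satisfied_conditions_compatible(2)[OF stable_p(1,2) cond_q])
  moreover have "stable R (fst p, snd p \<inter> snd q)" using stable_p(3) by (rule stable_subset) auto
  moreover have "satisfies (generated R G) (coded_condition (state p))"
    using satisfies_generated[OF _ stable_p(3,2)] stable_p(1) by (simp add: ideal_condition_def)
  ultimately show ?thesis using that by fastforce
qed

lemma generated_avoids:
  assumes Sigma0_C: "Sigma0_collection n COMP {} {} C"
    and avoids: "avoids I G (coding_collection {i. comp_index i \<and> comp_condition i \<in> C})"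
      (is "avoids I G (coding_collection ?W)")
  shows "avoids COMP (generated R G) C"
proof -
  obtain q where cond_q: "ideal_condition I q" "satisfies G q"
    and avoid: "\<And>r. r \<in> coding_collection ?W \<Longrightarrow> \<not> extends r q"
    using avoids by (auto simp: avoids_def)
  obtain p where stable_p: "p \<preceq> q" "stable R p"
    and satisfied: "satisfies (generated R G) (coded_condition (state p))"
    using cond_q by (rule obtain_stable_satisfied_extension)
  note ideal_p = ideal_extends_imp_condition[OF stable_p(1)]
  have "\<not> extends (E, T) (coded_condition (state p))" if mem: "(E, T) \<in> C" for E T
  proof
    assume extends_coded: "extends (E, T) (coded_condition (state p))"
    have comp: "ideal_condition COMP (E, T)" using Sigma0_C mem by (simp add: Sigma0_collection_def)
    then obtain e where computes_T: "computes {} e T"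
      by (auto simp: ideal_condition_def COMP_def turing_le_def)
    obtain r
      where pushed: "r \<preceq> p" "stable R r" "part (state r) = E"
        "stack (state r) = e # stack (state p)"
      using ex_stable_push[OF ideal_p stable_p(2) comp computes_T extends_coded] by blast
    have "top_index (state r) \<in> ?W"
      using comp_index_if_computes[OF comp computes_T] mem by (simp add: top_index_def pushed(3,4))
    then have "r \<in> coding_collection ?W"
      using pushed ideal_extends_imp_condition by (simp add: mem_coding_collection_iff)
    moreover have "r \<preceq> q" using pushed(1) stable_p(1) by (rule ideal_extends_trans)
    ultimately show False using avoid by (auto simp: ideal_extends_def)
  qed
  moreover have "ideal_condition COMP (coded_condition (state p))"
    by (intro ideal_condition_coded_condition stable_genuine[OF ideal_p stable_p(2)]
        finite_part_state_of)
  ultimately show ?thesis using satisfied unfolding avoids_def by fast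
qed

theorem mathias_generic_generated: "mathias_generic n COMP {} {} (generated R G)"
  unfolding mathias_generic_def
proof (intro allI impI)
  fix C assume Sigma0_C: "Sigma0_collection n COMP {} {} C"
  let ?W = "{i. comp_index i \<and> comp_condition i \<in> C}"
  have "meets G (coding_collection ?W) \<or> avoids I G (coding_collection ?W)"
    using generic Sigma0_coding_collection[OF Sigma0_comp_indices[OF Sigma0_C]]
    by (simp add: mathias_generic_def)
  then show "meets (generated R G) C \<or> avoids COMP (generated R G) C"
  proof
    assume "meets G (coding_collection ?W)"
    then obtain p where "p \<in> coding_collection ?W" "satisfies G p" by (auto simp: meets_def)
    then have "comp_condition (top_index (state p)) \<in> C"
      "satisfies (generated R G) (comp_condition (top_index (state p)))"
      using generated_satisfies_top by (auto simp: mem_coding_collection_iff)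
    then show ?thesis by (auto simp: meets_def)
  qed (use generated_avoids[OF Sigma0_C] in blast)
qed

end

theorem theorem5p6:
  fixes I :: "nat set set" and A0 A1 G :: "nat set" and n :: nat
  assumes "turing_ideal I"
    and "exact_pair I A0 A1"
    and "n \<ge> 3"
    and "mathias_generic n I A0 A1 G"
  shows "\<exists>H. H \<le>\<^sub>T G \<and> mathias_generic n COMP {} {} H"
proof -
  interpret generic_set I A0 A1 G n using assms by unfold_locales
  let ?J = "{S \<in> I. S \<le>\<^sub>T G}"
  show ?thesis
  proof (cases "\<forall>B\<in>?J. \<forall>R. decidable2 B R \<longrightarrow> projection R \<in> I")
    case True
    then interpret J: jump_ideal ?J
      using turing_ideal_below_generic generic_computes_projection by unfold_locales auto
    show ?thesis using J.ex_COMP_generic by blast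
  next
    case False
    then obtain B R where "B \<in> I" "B \<le>\<^sub>T G" "decidable2 B R" "projection R \<notin> I" by blast
    then interpret generic_coding I A0 A1 G n B R by unfold_locales
    show ?thesis using generated_turing_le mathias_generic_generated by blast
  qed
qed

end
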